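(* Let $\Delta\subseteq\mathbb{R}^d$ and, for $i\in\{1,\ldots,r\}$ with $r\ge 1$, let $g_i:\mathbb{R}^n\times\Delta\to\mathbb{R}$ be given by $$g_i(x,\delta)=\delta^\top A_i(x)\,\delta+b_i(x)^\top\delta+c_i(x),$$ where $A_i:\mathbb{R}^n\to\mathbb{R}^{d\times d}$ (without loss of generality $A_i(x)=A_i(x)^\top$), $b_i:\mathbb{R}^n\to\mathbb{R}^d$ and $c_i:\mathbb{R}^n\to\mathbb{R}$. Let $g(x,\delta)=\max_{i\in\{1,\ldots,r\}}g_i(x,\delta)$, and suppose the standing regularity assumption (see context) holds for $g$. For all $\epsilon\in(0,1)$ and $\beta\in(0,1)$, if the number of samples $N$ satisfies $$\sum_{j=0}^{\zeta-1}\binom{N}{j}\epsilon^j(1-\epsilon)^{N-j}\le\beta\qquad\text{with }\ \zeta=\frac{rd(d+3)}{2}+r,$$ then with confidence no smaller than $1-\beta$ (with respect to the random draw of $\omega\in\Delta^N$) the solution of $\mathrm{SP}[\omega]$ is feasible for $\mathrm{CCP}(\epsilon)$.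
   Context: Setting. $\delta$ is a random variable on a probability space $(\Delta,\mathcal{F},\mathbb{P})$ with $\Delta\subseteq\mathbb{R}^d$; $\mathcal{X}\subset\mathbb{R}^n$ is a compact convex set; $c\in\mathbb{R}^n$. The chance constrained program with acceptable violation probability $\epsilon\in(0,1)$ is $$\mathrm{CCP}(\epsilon):\quad \min_{x\in\mathcal{X}} c^\top x\quad\text{s.t.}\quad \mathbb{P}[g(x,\delta)\le 0]\ge 1-\epsilon .$$ Given a multi-sample $\omega=\{\delta^{(1)},\ldots,\delta^{(N)}\}\in\Delta^N$ of i.i.d. samples drawn according to $\mathbb{P}$, the scenario program is $$\mathrm{SP}[\omega]:\quad \min_{x\in\mathcal{X}} c^\top x \quad\text{s.t.}\quad g(x,\delta^{(j)})\le 0\ \ \forall j\in\{1,\ldots,N\}.$$ Standing regularity assumption. For almost all $\delta\in\Delta$, the function $x\mapsto g(x,\delta)$ is convex and lower semi-continuous. For any integer $N$, $\mathrm{SP}[\omega]$ is almost surely feasible, and its optimizer exists and is unique for almost all $\omega\in\Delta^N$. For all $x\in\mathcal{X}$, the mapping $\delta\mapsto g(x,\delta)$ is measurable. *)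

theory Defs
  imports "HOL-Probability.Probability"
begin

definition lower_semicont :: "('a::topological_space \<Rightarrow> real) \<Rightarrow> bool" where
  "lower_semicont f \<longleftrightarrow> (\<forall>x0. \<forall>y < f x0. eventually (\<lambda>x. y < f x) (nhds x0))"

text \<open>In all definitions below, \<open>P\<close> is the probability space of the uncertainty, so that
  \<open>space P\<close> is the set \<open>\<Delta>\<close>, and \<open>g x \<delta>\<close> is the constraint function. Only the values
  \<open>g x \<delta>\<close> with \<open>\<delta> \<in> space P\<close> matter.\<close>

definition ccp_feasible ::
    "'e measure \<Rightarrow> (real^'n) set \<Rightarrow> (real^'n \<Rightarrow> 'e \<Rightarrow> real) \<Rightarrow> real \<Rightarrow> real^'n \<Rightarrow> bool" where
  "ccp_feasible P X g \<epsilon> x \<longleftrightarrow> x \<in> X \<and> \<P>(\<delta> in P. g x \<delta> \<le> 0) \<ge> 1 - \<epsilon>"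

text \<open>A multi-sample of size \<open>N\<close> is a function on \<open>{1..N}\<close>. It is an ordered tuple, so repeated
  values are allowed, and i.i.d. drawing is the product measure.\<close>

abbreviation multisample :: "nat \<Rightarrow> 'e measure \<Rightarrow> (nat \<Rightarrow> 'e) measure" where
  "multisample N P \<equiv> Pi\<^sub>M {1..N} (\<lambda>_. P)"

definition sp_feasible ::
    "(real^'n) set \<Rightarrow> (real^'n \<Rightarrow> 'e \<Rightarrow> real) \<Rightarrow> nat \<Rightarrow> (nat \<Rightarrow> 'e) \<Rightarrow> real^'n \<Rightarrow> bool" where
  "sp_feasible X g N \<omega> x \<longleftrightarrow> x \<in> X \<and> (\<forall>j\<in>{1..N}. g x (\<omega> j) \<le> 0)"

definition sp_solution ::
    "real^'n \<Rightarrow> (real^'n) set \<Rightarrow> (real^'n \<Rightarrow> 'e \<Rightarrow> real) \<Rightarrow> nat \<Rightarrow> (nat \<Rightarrow> 'e) \<Rightarrow> real^'n \<Rightarrow> bool" where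
  "sp_solution c X g N \<omega> x \<longleftrightarrow> is_arg_min (\<lambda>y. c \<bullet> y) (sp_feasible X g N \<omega>) x"

text \<open>Scenario programs are only considered for at least one sample; nothing is demanded of the
  unconstrained problem of minimising over \<open>X\<close>.\<close>

definition standing_regularity ::
    "'e measure \<Rightarrow> real^'n \<Rightarrow> (real^'n) set \<Rightarrow> (real^'n \<Rightarrow> 'e \<Rightarrow> real) \<Rightarrow> bool" where
  "standing_regularity P c X g \<longleftrightarrow>
     (AE \<delta> in P. convex_on UNIV (\<lambda>x. g x \<delta>) \<and> lower_semicont (\<lambda>x. g x \<delta>)) \<and>
     (\<forall>N\<ge>1. (AE \<omega> in multisample N P. \<exists>x. sp_feasible X g N \<omega> x) \<and>
             (AE \<omega> in multisample N P. \<exists>!x. sp_solution c X g N \<omega> x)) \<and>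
     (\<forall>x\<in>X. (\<lambda>\<delta>. g x \<delta>) \<in> borel_measurable P)"

text \<open>The set of multi-samples whose scenario solution is feasible for the chance constrained
  program is in general measurable only up to a null set. Confidence at least \<open>p\<close> therefore means
  that this set contains an event of probability at least \<open>p\<close>; for a measurable set this is the
  same as having probability at least \<open>p\<close>.\<close>

definition with_confidence :: "'w measure \<Rightarrow> real \<Rightarrow> ('w \<Rightarrow> bool) \<Rightarrow> bool" where
  "with_confidence M p Q \<longleftrightarrow> (\<exists>E\<in>sets M. measure M E \<ge> p \<and> (\<forall>\<omega>\<in>E. Q \<omega>))"

end

theory Submission
  imports Defs
begin

text \<open>
  The functions \<open>g\<^sub>i\<close> are linear in the \<open>d(d+3)/2 + 1\<close> monomials of degree at most two in \<open>\<delta>\<close>, so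
  for more than \<open>\<zeta>\<close> samples the vector \<open>(g(x, \<delta>\<^sub>k))\<^sub>k\<close> lies, for every \<open>x\<close>, in one of finitely many
  proper subspaces. If more than \<open>\<zeta>\<close> constraints were all essential, Brouwer's theorem on
  the convex hull of the witnesses would yield a point at which this vector has any prescribed
  positive direction, a contradiction. Hence at most \<open>\<zeta>\<close> constraints determine the optimal value;
  only convexity of the maximum \<open>g\<close> is needed.

  Relaxing the constraints by \<open>\<rho>\<close> times independent uniform labels and adding \<open>\<rho>\<bar>x\<bar>\<^sup>2\<close> to the
  objective makes the minimiser and the determining set unique almost surely; the set is completed to
  exactly \<open>\<zeta>\<close> samples by the smallest labels. For a program with this uniqueness the
  probability that a new sample agrees with \<open>\<zeta>\<close> given ones has the moments of a beta distribution, which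
  gives the binomial tail. Fatou's lemma transfers the bound to the limit \<open>\<rho> \<rightarrow> 0\<close>.
\<close>

section \<open>Essential constraints\<close>

text \<open>A union bound over the index sets of size \<zeta> would lose a binomial factor. The
  exact tail needs that for almost every multi-sample exactly one such set agrees with all other
  samples: the corresponding events then partition the space up to a null set, and because this
  holds for every sample size, it fixes all moments of one and the same law. Ties between optimal
  values and determining sets with fewer than \<zeta> elements both destroy this partition, which is
  why objective and constraints are perturbed.

  The perturbation has a price. The vector of labels is a further direction besides the monomials,
  and a plain dimension count would then allow \<zeta> + 1 essential constraints. The sign of the
  relaxation wins this unit back, so \<zeta> stays as it is.

  The limit is taken in optimal values, not in minimisers: a sample that raises the unperturbed
  value also raises the perturbed values for all small \<rho>, and this one-sided statement is
  enough for an upper bound.\<close>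

lemma equalising_point:
  fixes h :: "'k \<Rightarrow> 'a::euclidean_space \<Rightarrow> real" and p :: "'k \<Rightarrow> 'a"
  assumes J: "finite J" "J \<noteq> {}" and C: "convex C" "\<And>j. j \<in> J \<Longrightarrow> p j \<in> C"
    and conv: "\<And>k. k \<in> J \<Longrightarrow> convex_on UNIV (h k)"
    and off: "\<And>j k. j \<in> J \<Longrightarrow> k \<in> J \<Longrightarrow> j \<noteq> k \<Longrightarrow> h k (p j) \<le> 0"
    and pos: "\<And>x. x \<in> C \<Longrightarrow> \<exists>k\<in>J. h k x > 0"
    and y: "\<And>k. k \<in> J \<Longrightarrow> y k > 0"
  obtains x t where "x \<in> C" "t > 0" "\<And>k. k \<in> J \<Longrightarrow> h k x = t * y k"
proof -
  define H where "H = convex hull (p ` J)"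
  have HC: "H \<subseteq> C"
    unfolding H_def using C by (intro hull_minimal) auto
  define u where "u k x = h k x / y k" for k x
  define m where "m x = Max ((\<lambda>k. u k x) ` J)" for x
  \<comment> \<open>\<open>d j\<close> is the shortfall of constraint \<open>j\<close> against the
    largest scaled one. All shortfalls vanish exactly when \<open>h k x = m x * y k\<close> for
    every \<open>k\<close>, so the scaling by \<open>y\<close> prescribes the direction.\<close>
  define d where "d j x = m x - u j x" for j x
  have cont_h: "continuous_on UNIV (h k)" if "k \<in> J" for k
    using conv[OF that] by (intro convex_on_continuous) auto
  have cont_u: "continuous_on UNIV (u k)" if "k \<in> J" for k
    unfolding u_def using cont_h[OF that] y[OF that] by (intro continuous_intros) auto
  have cont_m: "continuous_on UNIV m"
  proof -
    have "continuous_on UNIV (\<lambda>x. Max ((\<lambda>k. u k x) ` K))"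
      if "finite K" "K \<noteq> {}" "K \<subseteq> J" for K
      using that
    proof (induction K rule: finite_ne_induct)
      case (insert k K)
      then show ?case by (simp add: Max_insert) (intro continuous_on_max cont_u, auto)
    qed (auto intro: cont_u)
    then show ?thesis unfolding m_def using J by auto
  qed
  have cont_d: "continuous_on S (d j)" if "j \<in> J" for j S
    unfolding d_def using cont_u[OF that] cont_m
    by (intro continuous_intros) (auto intro: continuous_on_subset)
  have d_nonneg: "d j x \<ge> 0" if "j \<in> J" for j x
    unfolding d_def m_def using J that by simp
  have max_attained: "\<exists>k\<in>J. d k x = 0" for x
  proof -
    have "m x \<in> (\<lambda>k. u k x) ` J" unfolding m_def using J by (intro Max_in) auto
    then show ?thesis by (auto simp: d_def)
  qed
  have m_pos: "m x > 0" if xC: "x \<in> C" for x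
  proof -
    obtain k where k: "k \<in> J" "h k x > 0" using pos[OF xC] by auto
    then have "0 < u k x" using y by (simp add: u_def)
    also have "u k x \<le> m x" using d_nonneg[OF k(1), of x] by (simp add: d_def)
    finally show ?thesis .
  qed
  have "\<exists>x\<in>H. \<forall>j\<in>J. d j x = 0"
  proof (rule ccontr)
    assume neg: "\<not> ?thesis"
    define s where "s x = (\<Sum>j\<in>J. d j x)" for x
    have s_pos: "s x > 0" if "x \<in> H" for x
      unfolding s_def using neg that d_nonneg J
      by (subst less_le) (auto simp: sum_nonneg sum_nonneg_eq_0_iff)
    \<comment> \<open>Each shortfall weights its own vertex: \<open>p j\<close> is the only vertex
      at which constraint \<open>j\<close> may be positive, so \<open>T\<close> pulls towards the
      constraints that lag behind, as in KKM-type arguments. Division by \<open>s\<close> is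
      possible because the shortfalls are assumed to have no common zero.\<close>
    define T where "T x = (\<Sum>j\<in>J. (d j x / s x) *\<^sub>R p j)" for x
    have "continuous_on H T"
      unfolding T_def s_def using s_pos
      by (intro continuous_intros cont_d) (auto simp: s_def less_imp_neq[symmetric])
    moreover have "T x \<in> H" if "x \<in> H" for x
      unfolding T_def using s_pos[OF that] d_nonneg J
      by (intro convex_sum) (auto simp: H_def hull_inc sum_divide_distrib[symmetric] s_def)
    moreover have "compact H" "convex H" "H \<noteq> {}"
      using J by (auto simp: H_def finite_imp_compact_convex_hull)
    ultimately obtain x where x: "x \<in> H" "T x = x"
      using brouwer[of H T] by blast
    obtain k where k: "k \<in> J" "d k x = 0" using max_attained by blast
    \<comment> \<open>A fixed point avoids the vertex \<open>p k\<close> of an active constraint, so convexity makes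
      that constraint nonpositive there.\<close>
    have "h k x = h k (\<Sum>j\<in>J. (d j x / s x) *\<^sub>R p j)" using x(2) by (simp add: T_def)
    also have "\<dots> \<le> (\<Sum>j\<in>J. (d j x / s x) * h k (p j))"
      using s_pos[OF x(1)] d_nonneg J
      by (intro convex_on_sum[OF _ _ conv[OF k(1)]])
         (auto simp: sum_divide_distrib[symmetric] s_def)
    also have "\<dots> \<le> 0"
    proof (rule sum_nonpos)
      fix j assume j: "j \<in> J"
      show "d j x / s x * h k (p j) \<le> 0"
      proof (cases "j = k")
        case False
        then show ?thesis using off[OF j k(1)] d_nonneg[OF j, of x] s_pos[OF x(1)]
          by (intro mult_nonneg_nonpos) auto
      qed (simp add: k)
    qed
    finally have "u k x \<le> 0" using y[OF k(1)] by (simp add: u_def divide_nonpos_pos)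
    then show False using k(2) m_pos[of x] x(1) HC by (auto simp: d_def)
  qed
  then obtain x where x: "x \<in> H" "\<And>j. j \<in> J \<Longrightarrow> d j x = 0" by blast
  show thesis
  proof
    show "x \<in> C" "m x > 0" using x(1) HC m_pos by auto
    show "h k x = m x * y k" if "k \<in> J" for k
      using x(2)[OF that] y[OF that] by (simp add: d_def u_def field_simps)
  qed
qed

text \<open>The vectors of the values \<open>G x k\<close> lie in a finite union of hyperplanes with
  normals \<open>NN\<close>. One hyperplane would not do for a maximum, since the active piece
  varies with \<open>x\<close> and \<open>k\<close>; finiteness still lets one generic direction
  avoid them all. Quantifying over all large \<open>J\<close> makes the property pass to subsets
  such as a minimal basis.\<close>

definition rank_bounded :: "nat \<Rightarrow> 'a set \<Rightarrow> ('a \<Rightarrow> nat \<Rightarrow> real) \<Rightarrow> nat set \<Rightarrow> bool" where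
  "rank_bounded d X G K \<longleftrightarrow> (\<forall>J\<subseteq>K. card J > d \<longrightarrow>
     (\<exists>NN. finite NN \<and> (\<forall>\<nu>\<in>NN. \<exists>k\<in>J. \<nu> k \<noteq> 0) \<and>
        (\<forall>x\<in>X. \<exists>\<nu>\<in>NN. (\<Sum>k\<in>J. \<nu> k * G x k) = 0)))"

text \<open>The moment curve meets a hyperplane through the origin only at roots of a nonzero
  polynomial, hence finitely often. The exponent \<open>Suc k\<close> instead of \<open>k\<close>
  makes every coordinate tend to 0 with \<open>s\<close>, so that the curve can serve as a small
  push.\<close>

lemma eventually_power_sum_nonzero:
  fixes \<nu> :: "nat \<Rightarrow> real"
  assumes J: "finite J" "\<exists>k\<in>J. \<nu> k \<noteq> 0"
  shows "eventually (\<lambda>s. (\<Sum>k\<in>J. \<nu> k * s ^ Suc k) \<noteq> 0) (at_right 0)"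
proof -
  define p where "p = (\<Sum>k\<in>J. monom (\<nu> k) (Suc k))"
  have "coeff p (Suc k) = (if k \<in> J then \<nu> k else 0)" for k
    using J(1) by (simp add: p_def coeff_sum sum.delta')
  then have "p \<noteq> 0" using J(2) by (metis coeff_0)
  then have "finite {x. poly p x = 0}" by (rule poly_roots_finite)
  then have "\<not> 0 islimpt {x. poly p x = 0}" by (rule islimpt_finite)
  then have "eventually (\<lambda>x. x \<notin> {x. poly p x = 0}) (at 0)"
    by (simp add: islimpt_iff_eventually)
  then have "eventually (\<lambda>x. x \<notin> {x. poly p x = 0}) (at_right 0)"
    by (rule filter_leD[OF at_le, rotated]) auto
  then show ?thesis
    by eventually_elim (simp add: p_def poly_sum poly_monom)
qed

text \<open>The subtracted vector \<rho> \<theta> need not lie in the hyperplanes of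
  \<open>NN\<close>, and counting it as one more dimension would only give \<open>d + 1\<close>.
  Hence the violations are equalised along a direction close to \<theta> itself, so that
  \<open>G x\<close> is \<open>\<rho> + t\<close> times \<theta> plus \<open>t\<close> times a small
  push. A normal that is not orthogonal to \<theta> cannot annihilate this because the \<theta> part
  dominates; for one that is orthogonal to \<theta> the push alone gives a nonzero value.\<close>

lemma minimal_infeasible_card_le:
  fixes G :: "'a::euclidean_space \<Rightarrow> nat \<Rightarrow> real" and p :: "nat \<Rightarrow> 'a"
  assumes rank: "rank_bounded d X G J" and fin: "finite J"
    and C: "convex C" "C \<subseteq> X" "\<And>j. j \<in> J \<Longrightarrow> p j \<in> C"
    and conv: "\<And>k. k \<in> J \<Longrightarrow> convex_on UNIV (\<lambda>x. G x k)"
    and \<theta>: "\<And>k. k \<in> J \<Longrightarrow> \<theta> k \<ge> 0" and \<rho>: "\<rho> > 0"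
    and off: "\<And>j k. j \<in> J \<Longrightarrow> k \<in> J \<Longrightarrow> j \<noteq> k \<Longrightarrow> G (p j) k \<le> \<rho> * \<theta> k"
    and pos: "\<And>x. x \<in> C \<Longrightarrow> \<exists>k\<in>J. G x k > \<rho> * \<theta> k"
  shows "card J \<le> d"
proof (rule ccontr)
  assume "\<not> card J \<le> d"
  with rank have "\<exists>NN. finite NN \<and> (\<forall>\<nu>\<in>NN. \<exists>k\<in>J. \<nu> k \<noteq> 0) \<and>
        (\<forall>x\<in>X. \<exists>\<nu>\<in>NN. (\<Sum>k\<in>J. \<nu> k * G x k) = 0)"
    unfolding rank_bounded_def by simp
  then obtain NN where NN: "finite NN" "\<And>\<nu>. \<nu> \<in> NN \<Longrightarrow> \<exists>k\<in>J. \<nu> k \<noteq> 0"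
    "\<And>x. x \<in> X \<Longrightarrow> \<exists>\<nu>\<in>NN. (\<Sum>k\<in>J. \<nu> k * G x k) = 0"
    by auto
  have J: "J \<noteq> {}" using \<open>\<not> card J \<le> d\<close> by auto
  define R where "R \<nu> s = (\<Sum>k\<in>J. \<nu> k * s ^ Suc k)" for \<nu> :: "nat \<Rightarrow> real" and s
  define e where "e \<nu> = (\<Sum>k\<in>J. \<nu> k * \<theta> k)" for \<nu>
  have "eventually (\<lambda>s. if e \<nu> = 0 then R \<nu> s \<noteq> 0 else \<bar>R \<nu> s\<bar> < \<bar>e \<nu>\<bar>) (at_right 0)"
    if \<nu>: "\<nu> \<in> NN" for \<nu>
  proof (cases "e \<nu> = 0")
    case True
    then show ?thesis
      using eventually_power_sum_nonzero[OF fin NN(2)[OF \<nu>]] by (simp add: R_def)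
  next
    case False
    have "((\<lambda>s. \<Sum>k\<in>J. \<nu> k * s ^ Suc k) \<longlongrightarrow> (\<Sum>k\<in>J. \<nu> k * 0 ^ Suc k)) (at_right 0)"
      by (intro tendsto_intros)
    then have "((\<lambda>s. \<bar>R \<nu> s\<bar>) \<longlongrightarrow> 0) (at_right 0)"
      by (simp add: R_def tendsto_rabs_zero_iff)
    then show ?thesis using False by (simp add: order_tendstoD(2))
  qed
  then have "eventually (\<lambda>s. \<forall>\<nu>\<in>NN. if e \<nu> = 0 then R \<nu> s \<noteq> 0 else \<bar>R \<nu> s\<bar> < \<bar>e \<nu>\<bar>) (at_right 0)"
    using NN(1) by (simp add: eventually_ball_finite)
  then have "eventually (\<lambda>s. (\<forall>\<nu>\<in>NN. if e \<nu> = 0 then R \<nu> s \<noteq> 0 else \<bar>R \<nu> s\<bar> < \<bar>e \<nu>\<bar>) \<and> s > 0) (at_right 0)"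
    by (intro eventually_conj) (auto simp: eventually_at_right_less)
  from eventually_happens'[OF trivial_limit_at_right_real this] obtain s where s: "s > 0"
    "\<And>\<nu>. \<nu> \<in> NN \<Longrightarrow> if e \<nu> = 0 then R \<nu> s \<noteq> 0 else \<bar>R \<nu> s\<bar> < \<bar>e \<nu>\<bar>"
    by blast
  \<comment> \<open>A slight push of \<open>\<theta>\<close> along the moment curve leaves every hyperplane of \<open>NN\<close> behind.\<close>
  obtain x t where x: "x \<in> C" "t > 0"
    and eq: "\<And>k. k \<in> J \<Longrightarrow> G x k - \<rho> * \<theta> k = t * (\<theta> k + s ^ Suc k)"
  proof (rule equalising_point[OF fin J C(1) C(3), where h = "\<lambda>k x. G x k - \<rho> * \<theta> k" and y = "\<lambda>k. \<theta> k + s ^ Suc k"])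
    show "convex_on UNIV (\<lambda>x. G x k - \<rho> * \<theta> k)" if "k \<in> J" for k
      using convex_on_add[OF conv[OF that] convex_on_const[THEN iffD2, OF convex_UNIV], of "- (\<rho> * \<theta> k)"] by simp
    show "0 < \<theta> k + s ^ Suc k" if "k \<in> J" for k
      using \<theta>[OF that] s(1) by (simp add: add_nonneg_pos)
  qed (use off pos in force)+
  then obtain \<nu> where \<nu>: "\<nu> \<in> NN" "(\<Sum>k\<in>J. \<nu> k * G x k) = 0"
    using NN(3) C(2) by blast
  have "(\<Sum>k\<in>J. \<nu> k * G x k) = (\<Sum>k\<in>J. (\<rho> + t) * (\<nu> k * \<theta> k) + t * (\<nu> k * s ^ Suc k))"
  proof (rule sum.cong[OF refl])
    fix k assume "k \<in> J"
    then have "G x k = \<rho> * \<theta> k + t * (\<theta> k + s ^ Suc k)" using eq[of k] by simp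
    then show "\<nu> k * G x k = (\<rho> + t) * (\<nu> k * \<theta> k) + t * (\<nu> k * s ^ Suc k)"
      by (simp add: algebra_simps)
  qed
  also have "\<dots> = (\<rho> + t) * e \<nu> + t * R \<nu> s"
    by (simp add: sum.distrib sum_distrib_left e_def R_def)
  finally have *: "(\<rho> + t) * e \<nu> = - (t * R \<nu> s)" using \<nu>(2) by simp
  show False
  proof (cases "e \<nu> = 0")
    case True
    then show False using * s(2)[OF \<nu>(1)] x(2) by simp
  next
    case False
    \<comment> \<open>Here the sign of the relaxation enters: \<rho> and \<open>t\<close> add up
      instead of cancelling, so the coefficient of the \<theta> part exceeds that of the
      push.\<close>
    have "(\<rho> + t) * \<bar>e \<nu>\<bar> = t * \<bar>R \<nu> s\<bar>"
      using arg_cong[OF *, of abs] x(2) \<rho> by (simp add: abs_mult)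
    also have "\<dots> < t * \<bar>e \<nu>\<bar>" using False s(2)[OF \<nu>(1)] x(2) by simp
    finally have "\<rho> * \<bar>e \<nu>\<bar> < 0" by (simp add: algebra_simps)
    then show False using \<rho> by (simp add: mult_less_0_iff)
  qed
qed

section \<open>Linear dependence among the samples of a quadratic constraint\<close>

lemma underdetermined_system_nontrivial:
  fixes \<phi> :: "'k \<Rightarrow> 'f \<Rightarrow> real"
  assumes "finite F" "finite K" "card F < card K"
  shows "\<exists>\<nu>. (\<exists>k\<in>K. \<nu> k \<noteq> 0) \<and> (\<forall>a\<in>F. (\<Sum>k\<in>K. \<nu> k * \<phi> k a) = 0)"
  using assms
proof (induction F arbitrary: K \<phi> rule: finite_induct)
  case empty
  then have "K \<noteq> {}" by auto
  then show ?case by (intro exI[of _ "\<lambda>_. 1"]) auto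
next
  case (insert a F)
  show ?case
  proof (cases "\<forall>k\<in>K. \<phi> k a = 0")
    case True
    have "card F < card K" using insert by simp
    from insert.IH[OF insert.prems(1) this, of \<phi>] obtain \<nu> where
      "\<exists>k\<in>K. \<nu> k \<noteq> 0" "\<forall>a\<in>F. (\<Sum>k\<in>K. \<nu> k * \<phi> k a) = 0" by blast
    with True show ?thesis by (intro exI[of _ \<nu>]) auto
  next
    case False
    then obtain k0 where k0: "k0 \<in> K" "\<phi> k0 a \<noteq> 0" by blast
    define L where "L = K - {k0}"
    have K: "K = insert k0 L" "k0 \<notin> L" "finite L" using k0 insert.prems by (auto simp: L_def)
    have "card F < card L" using insert K by simp
    from insert.IH[OF K(3) this, of "\<lambda>k b. \<phi> k b - \<phi> k a / \<phi> k0 a * \<phi> k0 b"] obtain \<nu> where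
      \<nu>: "\<exists>k\<in>L. \<nu> k \<noteq> 0" "\<And>b. b \<in> F \<Longrightarrow> (\<Sum>k\<in>L. \<nu> k * (\<phi> k b - \<phi> k a / \<phi> k0 a * \<phi> k0 b)) = 0"
      by blast
    define s where "s = (\<Sum>k\<in>L. \<nu> k * \<phi> k a)"
    define \<mu> where "\<mu> k = (if k = k0 then - s / \<phi> k0 a else \<nu> k)" for k
    have sum_\<mu>: "(\<Sum>k\<in>K. \<mu> k * \<phi> k b) = - s / \<phi> k0 a * \<phi> k0 b + (\<Sum>k\<in>L. \<nu> k * \<phi> k b)" for b
    proof -
      have "(\<Sum>k\<in>L. \<mu> k * \<phi> k b) = (\<Sum>k\<in>L. \<nu> k * \<phi> k b)"
        using K by (intro sum.cong) (auto simp: \<mu>_def)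
      then show ?thesis using K by (simp add: \<mu>_def)
    qed
    have "(\<Sum>k\<in>K. \<mu> k * \<phi> k b) = 0" if "b \<in> insert a F" for b
    proof (cases "b = a")
      case True
      then show ?thesis using k0 by (simp add: sum_\<mu> s_def)
    next
      case False
      then have "0 = (\<Sum>k\<in>L. \<nu> k * (\<phi> k b - \<phi> k a / \<phi> k0 a * \<phi> k0 b))"
        using \<nu>(2) that by simp
      also have "\<dots> = (\<Sum>k\<in>L. \<nu> k * \<phi> k b - \<nu> k * \<phi> k a * (\<phi> k0 b / \<phi> k0 a))"
        by (intro sum.cong) (auto simp: algebra_simps)
      also have "\<dots> = (\<Sum>k\<in>L. \<nu> k * \<phi> k b) - s * (\<phi> k0 b / \<phi> k0 a)"
        by (simp only: sum_subtractf s_def sum_distrib_right)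
      finally show ?thesis by (simp add: sum_\<mu>)
    qed
    moreover have "\<exists>k\<in>K. \<mu> k \<noteq> 0" using \<nu>(1) K by (auto simp: \<mu>_def)
    ultimately show ?thesis by blast
  qed
qed

text \<open>Pigeonhole: if \<open>p\<close> records the piece active at each sample, more than
  \<open>card R * card F\<close> samples put more than \<open>card F\<close> on one piece, and these
  are linearly dependent in the features \<open>\<phi>\<close>. The normal depends on
  \<open>x\<close> only through \<open>p\<close>, and there are finitely many
  \<open>p\<close>.\<close>

lemma rank_bounded_pointwise_choice:
  fixes \<phi> :: "nat \<Rightarrow> 'f \<Rightarrow> real" and gi :: "'i \<Rightarrow> 'a \<Rightarrow> nat \<Rightarrow> real"
  assumes F: "finite F" and R: "finite R"
    and lin: "\<And>i x L \<nu>. i \<in> R \<Longrightarrow> x \<in> X \<Longrightarrow> L \<subseteq> K \<Longrightarrow> finite L \<Longrightarrow>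
      (\<And>a. a \<in> F \<Longrightarrow> (\<Sum>k\<in>L. \<nu> k * \<phi> k a) = 0) \<Longrightarrow> (\<Sum>k\<in>L. \<nu> k * gi i x k) = 0"
    and G: "\<And>x k. x \<in> X \<Longrightarrow> k \<in> K \<Longrightarrow> \<exists>i\<in>R. G x k = gi i x k"
  shows "rank_bounded (card R * card F) X G K"
  unfolding rank_bounded_def
proof (intro allI impI)
  fix J assume JK: "J \<subseteq> K" and J: "card J > card R * card F"
  have finJ: "finite J" using J card.infinite by fastforce
  define B where "B p i = {k\<in>J. p k = i}" for p :: "nat \<Rightarrow> 'i" and i
  have "\<exists>\<nu>. (\<exists>k\<in>J. \<nu> k \<noteq> 0) \<and> (\<exists>i\<in>R. (\<forall>k\<in>J - B p i. \<nu> k = 0) \<and>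
          (\<forall>a\<in>F. (\<Sum>k\<in>B p i. \<nu> k * \<phi> k a) = 0))" if p: "p \<in> J \<rightarrow>\<^sub>E R" for p
  proof -
    have "\<exists>i\<in>R. card F < card (B p i)"
    proof (rule ccontr)
      assume "\<not> ?thesis"
      then have "(\<Sum>i\<in>R. card (B p i)) \<le> card R * card F"
        using sum_bounded_above[of R "\<lambda>i. card (B p i)" "card F"] by force
      moreover have "J = (\<Union>i\<in>R. B p i)" using p by (auto simp: B_def)
      then have "card J \<le> (\<Sum>i\<in>R. card (B p i))" using card_UN_le[OF R] by metis
      ultimately show False using J by simp
    qed
    then obtain i where i: "i \<in> R" "card F < card (B p i)" by blast
    obtain \<nu> where \<nu>: "\<exists>k\<in>B p i. \<nu> k \<noteq> 0" "\<forall>a\<in>F. (\<Sum>k\<in>B p i. \<nu> k * \<phi> k a) = 0"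
      using underdetermined_system_nontrivial[OF F _ i(2), of \<phi>] finJ by (auto simp: B_def)
    have "(\<Sum>k\<in>B p i. (if k \<in> B p i then \<nu> k else 0) * \<phi> k a) = 0" if "a \<in> F" for a
      using \<nu>(2) that by simp
    then show ?thesis
      using \<nu>(1) i(1) by (intro exI[of _ "\<lambda>k. if k \<in> B p i then \<nu> k else 0"]) (auto simp: B_def)
  qed
  then have "\<forall>p\<in>J \<rightarrow>\<^sub>E R. \<exists>\<nu>. (\<exists>k\<in>J. \<nu> k \<noteq> 0) \<and> (\<exists>i\<in>R. (\<forall>k\<in>J - B p i. \<nu> k = 0) \<and>
          (\<forall>a\<in>F. (\<Sum>k\<in>B p i. \<nu> k * \<phi> k a) = 0))" by blast
  from bchoice[OF this] obtain \<nu> where \<nu>: "\<And>p. p \<in> J \<rightarrow>\<^sub>E R \<Longrightarrow> (\<exists>k\<in>J. \<nu> p k \<noteq> 0) \<and>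
      (\<exists>i\<in>R. (\<forall>k\<in>J - B p i. \<nu> p k = 0) \<and> (\<forall>a\<in>F. (\<Sum>k\<in>B p i. \<nu> p k * \<phi> k a) = 0))"
    by auto
  have "\<exists>p\<in>J \<rightarrow>\<^sub>E R. (\<Sum>k\<in>J. \<nu> p k * G x k) = 0" if x: "x \<in> X" for x
  proof -
    define p where "p = (\<lambda>k\<in>J. SOME i. i \<in> R \<and> G x k = gi i x k)"
    have p: "p k \<in> R \<and> G x k = gi (p k) x k" if "k \<in> J" for k
      using someI_ex[of "\<lambda>i. i \<in> R \<and> G x k = gi i x k"] G[OF x, of k] that JK
      by (auto simp: p_def)
    have pE: "p \<in> J \<rightarrow>\<^sub>E R" using p by (auto simp: p_def)
    from \<nu>[OF this] obtain i where i: "i \<in> R" "\<And>k. k \<in> J - B p i \<Longrightarrow> \<nu> p k = 0"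
      "\<And>a. a \<in> F \<Longrightarrow> (\<Sum>k\<in>B p i. \<nu> p k * \<phi> k a) = 0" by blast
    have "(\<Sum>k\<in>J. \<nu> p k * G x k) = (\<Sum>k\<in>B p i. \<nu> p k * G x k)"
      using i(2) finJ by (intro sum.mono_neutral_right) (auto simp: B_def)
    also have "\<dots> = (\<Sum>k\<in>B p i. \<nu> p k * gi i x k)"
      using p by (intro sum.cong) (auto simp: B_def)
    also have "\<dots> = 0"
      using finJ JK i(3) by (intro lin[OF i(1) x]) (auto simp: B_def)
    finally show ?thesis using pE by blast
  qed
  then show "\<exists>NN. finite NN \<and> (\<forall>\<nu>\<in>NN. \<exists>k\<in>J. \<nu> k \<noteq> 0) \<and> (\<forall>x\<in>X. \<exists>\<nu>\<in>NN. (\<Sum>k\<in>J. \<nu> k * G x k) = 0)"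
    using \<nu> finJ R by (intro exI[of _ "\<nu> ` (J \<rightarrow>\<^sub>E R)"]) (auto intro: finite_PiE)
qed

lemma rank_bounded_max_quadratic:
  fixes A :: "nat \<Rightarrow> 'a \<Rightarrow> real^'d^'d" and b :: "nat \<Rightarrow> 'a \<Rightarrow> real^'d"
    and \<delta> :: "nat \<Rightarrow> real^'d"
  assumes r: "r \<ge> 1"
    and gi: "\<And>i x k. i \<in> {1..r} \<Longrightarrow> k \<in> K \<Longrightarrow>
           gi i x (\<delta> k) = \<delta> k \<bullet> (A i x *v \<delta> k) + b i x \<bullet> \<delta> k + c i x"
    and g: "\<And>x k. k \<in> K \<Longrightarrow> g x (\<delta> k) = Max ((\<lambda>i. gi i x (\<delta> k)) ` {1..r})"
  shows "rank_bounded (r * CARD('d) * (CARD('d) + 3) div 2 + r) X (\<lambda>x k. g x (\<delta> k)) K"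
proof -
  \<comment> \<open>Monomials of degree at most two are encoded as sets of one or two elements of
    \<open>'d option\<close>: \<open>None\<close> is the homogenising coordinate 1, and a singleton
    stands for a square. With \<open>D = CARD('d)\<close> there are
    \<open>(D + 1) + D (D + 1) / 2\<close> of them, and \<open>r\<close> times this number is the
    \<zeta> of the theorem.\<close>
  define e where "e v a = (case a of None \<Rightarrow> 1 | Some a \<Rightarrow> v $ a)" for v :: "real^'d" and a
  define F where "F = {S::'d option set. card S = 1} \<union> {S. card S = 2}"
  define \<phi> where "\<phi> k S = (if card S = 1 then (\<Prod>a\<in>S. e (\<delta> k) a) ^ 2 else (\<Prod>a\<in>S. e (\<delta> k) a))" for k S
  have mono: "\<phi> k {a, a'} = e (\<delta> k) a * e (\<delta> k) a' \<and> {a, a'} \<in> F" for k a a'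
    by (cases "a = a'") (auto simp: \<phi>_def F_def power2_eq_square)
  have cards: "card {S::'d option set. card S = m} = Suc CARD('d) choose m" for m
    using n_subsets[of "UNIV :: 'd option set" m] by (simp add: card_UNIV_option)
  have "card F = card {S::'d option set. card S = 1} + card {S::'d option set. card S = 2}"
    unfolding F_def by (intro card_Un_disjoint) auto
  also have "\<dots> = Suc CARD('d) + Suc CARD('d) * CARD('d) div 2"
    unfolding cards by (simp add: choose_two)
  finally have "2 * card F = CARD('d) * (CARD('d) + 3) + 2"
    by (simp add: algebra_simps)
  \<comment> \<open>The product is even, so \<open>div 2\<close> is exact.\<close>
  then have "r * CARD('d) * (CARD('d) + 3) = 2 * (r * (card F - 1))"
    by (simp add: algebra_simps)
  moreover have "card F \<ge> 1" using \<open>2 * card F = _\<close> by simp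
  ultimately have card: "r * CARD('d) * (CARD('d) + 3) div 2 + r = card {1..r} * card F"
    by (cases "card F") (auto simp: mult.assoc)
  show ?thesis
    unfolding card
  proof (rule rank_bounded_pointwise_choice[where \<phi> = \<phi> and gi = "\<lambda>i x k. gi i x (\<delta> k)"])
    fix i x L \<nu> assume i: "i \<in> {1..r}" and L: "L \<subseteq> K"
      and *: "\<And>a. a \<in> F \<Longrightarrow> (\<Sum>k\<in>L. \<nu> k * \<phi> k a) = 0"
    have **: "(\<Sum>k\<in>L. \<nu> k * (e (\<delta> k) a * e (\<delta> k) a')) = 0" for a a'
      using mono[of _ a a'] *[of "{a, a'}"] by simp
    have quad: "(\<Sum>k\<in>L. \<nu> k * (\<delta> k $ a * \<delta> k $ a')) = 0" for a a'
      using **[of "Some a" "Some a'"] by (simp add: e_def)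
    have linear: "(\<Sum>k\<in>L. \<nu> k * \<delta> k $ a) = 0" for a
      using **[of "Some a" None] by (simp add: e_def)
    have const: "(\<Sum>k\<in>L. \<nu> k) = 0"
      using **[of None None] by (simp add: e_def)
    have "(\<Sum>k\<in>L. \<nu> k * gi i x (\<delta> k)) =
      (\<Sum>k\<in>L. (\<Sum>a\<in>UNIV. \<Sum>a'\<in>UNIV. A i x $ a $ a' * (\<nu> k * (\<delta> k $ a * \<delta> k $ a'))) +
            (\<Sum>a\<in>UNIV. b i x $ a * (\<nu> k * \<delta> k $ a)) + c i x * \<nu> k)"
      using L i by (intro sum.cong refl)
        (auto simp: gi subset_iff inner_vec_def matrix_vector_mult_def sum_distrib_left algebra_simps)
    also have "\<dots> = (\<Sum>a\<in>UNIV. \<Sum>a'\<in>UNIV. A i x $ a $ a' * (\<Sum>k\<in>L. \<nu> k * (\<delta> k $ a * \<delta> k $ a'))) +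
            (\<Sum>a\<in>UNIV. b i x $ a * (\<Sum>k\<in>L. \<nu> k * \<delta> k $ a)) + c i x * (\<Sum>k\<in>L. \<nu> k)"
      unfolding sum.distrib sum_distrib_left
      by (subst (1 2 4) sum.swap) (simp add: sum.swap[of _ UNIV L])
    finally show "(\<Sum>k\<in>L. \<nu> k * gi i x (\<delta> k)) = 0"
      by (simp add: quad linear const)
  next
    fix x k assume k: "k \<in> K"
    have "Max ((\<lambda>i. gi i x (\<delta> k)) ` {1..r}) \<in> (\<lambda>i. gi i x (\<delta> k)) ` {1..r}"
      using r by (intro Max_in) auto
    then show "\<exists>i\<in>{1..r}. g x (\<delta> k) = gi i x (\<delta> k)" using g[OF k] by auto
  qed auto
qed

section \<open>Unique determining sets\<close>

lemma exists_initial_segment: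
  fixes \<theta> :: "'k \<Rightarrow> real"
  assumes "finite S" "m \<le> card S"
  shows "\<exists>E\<subseteq>S. card E = m \<and> (\<forall>a\<in>E. \<forall>b\<in>S - E. \<theta> a \<le> \<theta> b)"
  using assms(2)
proof (induction m)
  case 0
  then show ?case by (intro exI[of _ "{}"]) auto
next
  case (Suc m)
  then obtain E where E: "E \<subseteq> S" "card E = m" "\<forall>a\<in>E. \<forall>b\<in>S - E. \<theta> a \<le> \<theta> b" by auto
  have "S - E \<noteq> {}" using E Suc.prems by auto
  then obtain c where c: "c \<in> S - E" "\<And>b. b \<in> S - E \<Longrightarrow> \<theta> c \<le> \<theta> b"
    using assms(1) by (metis finite_Diff arg_min_if_finite(1) arg_min_least)
  show ?case
    using E c assms(1) by (intro exI[of _ "insert c E"]) (auto simp: finite_subset)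
qed

text \<open>\<open>W (I - {b}) = W I\<close> recognises from \<open>I\<close> alone a member
  \<open>b\<close> that only fills \<open>I\<close> up to the required size. Whether
  \<open>j\<close> escapes thus depends on \<open>I\<close> and \<open>j\<close> and not on the
  remaining samples, as the later independence of the tests demands.\<close>

definition escapes :: "(nat set \<Rightarrow> real) \<Rightarrow> (nat \<Rightarrow> real) \<Rightarrow> nat set \<Rightarrow> nat \<Rightarrow> bool" where
  "escapes W \<theta> I j \<longleftrightarrow> W (insert j I) > W I \<or> (\<exists>b\<in>I. W (I - {b}) = W I \<and> \<theta> j < \<theta> b)"

text \<open>This is an LP-type problem: \<open>mono\<close>, \<open>loc\<close> and
  \<open>dim\<close> are monotonicity, locality and combinatorial dimension. By
  \<open>nondeg\<close> a smallest basis \<open>B\<close> is contained in every subset with the full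
  value, for a missing element of \<open>B\<close> would force the two values apart. The sets of
  size \<open>d\<close> that no outside index escapes are therefore \<open>B\<close> together with
  the \<open>d - card B\<close> smallest labels outside \<open>B\<close>, and distinct labels leave
  one choice.\<close>

lemma unique_pinned_basis:
  fixes W :: "nat set \<Rightarrow> real" and \<theta> :: "nat \<Rightarrow> real"
  assumes G: "finite G" "d \<le> card G" and inj: "inj_on \<theta> G"
    and mono: "\<And>H K. H \<subseteq> K \<Longrightarrow> K \<subseteq> G \<Longrightarrow> W H \<le> W K"
    and loc: "\<And>H. H \<subseteq> G \<Longrightarrow> (\<And>j. j \<in> G \<Longrightarrow> W (insert j H) = W H) \<Longrightarrow> W G = W H"
    and dim: "\<exists>B\<subseteq>G. card B \<le> d \<and> W B = W G"
    and nondeg: "\<And>H K k. H \<subseteq> G \<Longrightarrow> K \<subseteq> G \<Longrightarrow> k \<in> H - K \<Longrightarrow> W (H - {k}) < W H \<Longrightarrow> W H \<noteq> W K"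
  shows "\<exists>!I. I \<subseteq> G \<and> card I = d \<and> (\<forall>j\<in>G - I. \<not> escapes W \<theta> I j)"
proof -
  define B where "B = (ARG_MIN card B. B \<subseteq> G \<and> W B = W G)"
  have B: "B \<subseteq> G" "W B = W G" and Bmin: "\<And>H. H \<subseteq> G \<Longrightarrow> W H = W G \<Longrightarrow> card B \<le> card H"
    using arg_min_nat_lemma[of "\<lambda>B. B \<subseteq> G \<and> W B = W G" G card] by (auto simp: B_def)
  have finB: "finite B" using B G finite_subset by blast
  have cardB: "card B \<le> d" using dim Bmin by (meson le_trans)
  have essential: "W (B - {k}) < W B" if "k \<in> B" for k
  proof -
    have "card (B - {k}) < card B" using finB that by (rule card_Diff1_less)
    then have "W (B - {k}) \<noteq> W G" using Bmin[of "B - {k}"] B by force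
    then show ?thesis using mono[of "B - {k}" G] B by force
  qed
  have absorb: "W H = W G \<longleftrightarrow> B \<subseteq> H" if "H \<subseteq> G" for H
  proof
    assume WH: "W H = W G"
    show "B \<subseteq> H"
    proof
      fix k assume k: "k \<in> B"
      show "k \<in> H"
        using nondeg[OF B(1) that, of k] essential[OF k] k WH B(2) by auto
    qed
  next
    assume "B \<subseteq> H"
    then show "W H = W G" using mono[of B H] mono[of H G] that B(2) by auto
  qed
  have pinned_iff: "(\<forall>j\<in>G - I. \<not> escapes W \<theta> I j) \<longleftrightarrow>
      B \<subseteq> I \<and> (\<forall>b\<in>I - B. \<forall>j\<in>G - I. \<theta> b \<le> \<theta> j)" if I: "I \<subseteq> G" for I
  proof
    assume L: "\<forall>j\<in>G - I. \<not> escapes W \<theta> I j"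
    have "W (insert j I) = W I" if "j \<in> G" for j
    proof (cases "j \<in> I")
      case False
      then have "\<not> W (insert j I) > W I" using L that by (auto simp: escapes_def)
      then show ?thesis using mono[of I "insert j I"] I that by (simp add: subset_insertI)
    qed (simp add: insert_absorb)
    then have BI: "B \<subseteq> I" using loc[OF I] absorb[OF I] by simp
    have "W (I - {b}) = W I" if "b \<in> I - B" for b
    proof -
      have "B \<subseteq> I - {b}" "I - {b} \<subseteq> G" using BI I that by auto
      then show ?thesis using absorb[of "I - {b}"] absorb[OF I] BI by simp
    qed
    then show "B \<subseteq> I \<and> (\<forall>b\<in>I - B. \<forall>j\<in>G - I. \<theta> b \<le> \<theta> j)"
      using L BI by (meson DiffD1 escapes_def linorder_not_le)
  next
    assume R: "B \<subseteq> I \<and> (\<forall>b\<in>I - B. \<forall>j\<in>G - I. \<theta> b \<le> \<theta> j)"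
    show "\<forall>j\<in>G - I. \<not> escapes W \<theta> I j"
    proof
      fix j assume j: "j \<in> G - I"
      have "W (insert j I) = W I"
        using R j I absorb[of I] absorb[of "insert j I"] by auto
      moreover have "\<not> \<theta> j < \<theta> b" if "b \<in> I" "W (I - {b}) = W I" for b
      proof -
        have "B \<subseteq> I - {b}" using absorb[of "I - {b}"] absorb[OF I] R I that by auto
        then show ?thesis using R j that by force
      qed
      ultimately show "\<not> escapes W \<theta> I j" by (auto simp: escapes_def)
    qed
  qed
  have "d - card B \<le> card (G - B)"
    using G B finB by (simp add: card_Diff_subset)
  then obtain E where E: "E \<subseteq> G - B" "card E = d - card B" "\<forall>a\<in>E. \<forall>b\<in>G - B - E. \<theta> a \<le> \<theta> b"
    using exists_initial_segment[of "G - B" "d - card B" \<theta>] G by auto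
  show ?thesis
  proof (rule ex_ex1I)
    have "card (B \<union> E) = d"
      using E finB cardB G by (subst card_Un_disjoint) (auto intro: finite_subset)
    then show "\<exists>I. I \<subseteq> G \<and> card I = d \<and> (\<forall>j\<in>G - I. \<not> escapes W \<theta> I j)"
      using E B pinned_iff[of "B \<union> E"] by (intro exI[of _ "B \<union> E"]) auto
  next
    fix I I' assume "I \<subseteq> G \<and> card I = d \<and> (\<forall>j\<in>G - I. \<not> escapes W \<theta> I j)"
      and "I' \<subseteq> G \<and> card I' = d \<and> (\<forall>j\<in>G - I'. \<not> escapes W \<theta> I' j)"
    then have I: "I \<subseteq> G" "card I = d" "B \<subseteq> I" "\<forall>b\<in>I - B. \<forall>j\<in>G - I. \<theta> b \<le> \<theta> j"
      and I': "I' \<subseteq> G" "card I' = d" "B \<subseteq> I'" "\<forall>b\<in>I' - B. \<forall>j\<in>G - I'. \<theta> b \<le> \<theta> j"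
      using pinned_iff[of I] pinned_iff[of I'] by auto
    have fin: "finite I" "finite I'" using I I' G by (auto intro: finite_subset)
    show "I = I'"
    proof (rule ccontr)
      assume "I \<noteq> I'"
      then obtain a where a: "a \<in> I - I'" using fin I(2) I'(2) card_subset_eq[of I' I] by auto
      obtain a' where a': "a' \<in> I' - I"
        using \<open>I \<noteq> I'\<close> fin I(2) I'(2) card_subset_eq[of I I'] by auto
      have "a \<in> I - B" "a' \<in> G - I" "a' \<in> I' - B" "a \<in> G - I'" using a a' I I' by auto
      then have "\<theta> a \<le> \<theta> a'" "\<theta> a' \<le> \<theta> a" using I(4) I'(4) by blast+
      then have "a = a'" using inj_onD[OF inj, of a a'] \<open>a \<in> G - I'\<close> \<open>a' \<in> G - I\<close> by simp
      then show False using a a' by simp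
    qed
  qed
qed

section \<open>Convex programs\<close>

text \<open>Convexity of \<open>q\<close> on the whole space, not on \<open>X\<close> alone, yields
  continuity up to the boundary of \<open>X\<close>. The strict bound \<open>below_T\<close>
  separates infeasible programs from feasible ones by their value.\<close>

locale convex_program =
  fixes X :: "'a::euclidean_space set" and f :: "'a \<Rightarrow> real" and T :: real
    and q :: "'a \<Rightarrow> 'z \<Rightarrow> real"
  assumes compact_X: "compact X" and convex_X: "convex X"
    and cont_f: "continuous_on X f" and convex_f: "convex_on X f"
    and below_T: "\<And>x. x \<in> X \<Longrightarrow> f x < T"
    and convex_q: "\<And>z. convex_on UNIV (\<lambda>x. q x z)"
begin

definition feas :: "'z set \<Rightarrow> 'a set" where
  "feas S = {x\<in>X. \<forall>z\<in>S. q x z \<le> 0}"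

text \<open>The optimal value; \<open>T\<close> plays the role of \<open>\<infinity>\<close> for infeasible programs.\<close>

definition val :: "'z set \<Rightarrow> real" where
  "val S = Inf (insert T (f ` feas S))"

lemma cont_q: "continuous_on S (\<lambda>x. q x z)"
  using convex_on_continuous[OF open_UNIV convex_q] continuous_on_subset by blast

lemma feas_mono: "S \<subseteq> S' \<Longrightarrow> feas S' \<subseteq> feas S"
  by (auto simp: feas_def)

lemma compact_feas: "compact (feas S)"
proof -
  have "feas S = X \<inter> (\<Inter>z\<in>S. {x. q x z \<le> 0})" by (auto simp: feas_def)
  moreover have "closed (\<Inter>z\<in>S. {x. q x z \<le> 0})"
    by (intro closed_INT ballI closed_Collect_le cont_q continuous_on_const)
  ultimately show ?thesis using compact_X by (simp add: compact_Int_closed)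
qed

lemma val_attained:
  assumes "feas S \<noteq> {}"
  obtains x where "x \<in> feas S" "f x = val S" "\<And>y. y \<in> feas S \<Longrightarrow> f x \<le> f y"
proof -
  have "continuous_on (feas S) f"
    using cont_f by (rule continuous_on_subset) (auto simp: feas_def)
  from continuous_attains_inf[OF compact_feas assms this]
  obtain x where x: "x \<in> feas S" "\<And>y. y \<in> feas S \<Longrightarrow> f x \<le> f y" by blast
  moreover have "val S = f x"
    unfolding val_def using x below_T[of x] by (intro cInf_eq_minimum) (auto simp: feas_def)
  ultimately show ?thesis using that by metis
qed

lemma val_infeasible: "feas S = {} \<Longrightarrow> val S = T"
  by (simp add: val_def)

lemma val_le: 
  assumes "x \<in> feas S" shows "val S \<le> f x"
proof -
  have "feas S \<noteq> {}" using assms by blast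
  then show ?thesis by (rule val_attained) (use assms in metis)
qed

lemma val_less_T_iff: "val S < T \<longleftrightarrow> feas S \<noteq> {}"
proof
  assume "feas S \<noteq> {}"
  then obtain x where x: "x \<in> feas S" by blast
  then have "f x < T" by (intro below_T) (simp add: feas_def)
  then show "val S < T" using val_le[OF x] by simp
qed (use val_infeasible in force)

lemma val_le_T: "val S \<le> T"
  using val_less_T_iff[of S] val_infeasible[of S] by (cases "feas S = {}") auto

lemma val_less_iff:
  assumes "v \<le> T" shows "val S < v \<longleftrightarrow> (\<exists>x\<in>feas S. f x < v)"
proof
  assume L: "val S < v"
  then have "feas S \<noteq> {}" using val_infeasible[of S] assms by auto
  then obtain x where "x \<in> feas S" "f x = val S" by (rule val_attained)
  then show "\<exists>x\<in>feas S. f x < v" using L by (intro bexI[of _ x]) auto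
qed (use val_le in force)

lemma val_le_iff:
  assumes "v < T" shows "val S \<le> v \<longleftrightarrow> (\<exists>x\<in>feas S. f x \<le> v)"
proof
  assume L: "val S \<le> v"
  then have "feas S \<noteq> {}" using val_infeasible[of S] assms by auto
  then obtain x where "x \<in> feas S" "f x = val S" by (rule val_attained)
  then show "\<exists>x\<in>feas S. f x \<le> v" using L by (intro bexI[of _ x]) auto
qed (use val_le in force)

lemma val_mono:
  assumes "S \<subseteq> S'" shows "val S \<le> val S'"
proof (cases "feas S' = {}")
  case False
  then obtain x where "x \<in> feas S'" "f x = val S'" by (rule val_attained)
  then show ?thesis using feas_mono[OF assms] val_le[of x S] by auto
qed (simp add: val_infeasible val_le_T)

text \<open>In a smallest \<open>B\<close> with the full value \<open>v\<close>, dropping any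
  constraint leads below \<open>v\<close>. So on the convex sublevel set \<open>f < v\<close> the
  constraints of \<open>B\<close> are jointly unsatisfiable, while all but any one can be met. If
  \<open>K\<close> is infeasible, \<open>v\<close> is \<open>T\<close> and the sublevel set is all
  of \<open>X\<close>, so no separate case arises.\<close>

lemma small_basis:
  fixes z :: "nat \<Rightarrow> 'z" and G :: "'a \<Rightarrow> nat \<Rightarrow> real"
  assumes q: "\<And>x k. k \<in> K \<Longrightarrow> q x (z k) = G x k - \<rho> * \<theta> k"
    and rank: "rank_bounded d X G K" and K: "finite K"
    and \<theta>: "\<And>k. k \<in> K \<Longrightarrow> \<theta> k \<ge> 0" and \<rho>: "\<rho> > 0"
  shows "\<exists>B\<subseteq>K. card B \<le> d \<and> val (z ` B) = val (z ` K)"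
proof -
  define v where "v = val (z ` K)"
  define B where "B = (ARG_MIN card B. B \<subseteq> K \<and> val (z ` B) = v)"
  have B: "B \<subseteq> K" "val (z ` B) = v"
    and Bmin: "\<And>H. H \<subseteq> K \<Longrightarrow> val (z ` H) = v \<Longrightarrow> card B \<le> card H"
    using arg_min_nat_lemma[of "\<lambda>B. B \<subseteq> K \<and> val (z ` B) = v" K card] by (auto simp: B_def v_def)
  have finB: "finite B" using B K finite_subset by blast
  define C where "C = {x\<in>X. f x < v}"
  have "\<exists>x\<in>C. x \<in> feas (z ` (B - {k}))" if k: "k \<in> B" for k
  proof -
    have "card (B - {k}) < card B" using finB k by (rule card_Diff1_less)
    then have "val (z ` (B - {k})) \<noteq> v" using Bmin[of "B - {k}"] B by force
    then have "val (z ` (B - {k})) < v"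
      using val_mono[of "z ` (B - {k})" "z ` B"] B by force
    moreover have "v \<le> T" by (simp add: v_def val_le_T)
    ultimately show ?thesis
      by (auto simp: val_less_iff C_def feas_def)
  qed
  then obtain p where p: "\<And>k. k \<in> B \<Longrightarrow> p k \<in> C \<and> p k \<in> feas (z ` (B - {k}))"
    by metis
  have "card B \<le> d"
  proof (rule minimal_infeasible_card_le[where G = G and X = X and C = C and p = p and \<theta> = \<theta> and \<rho> = \<rho>])
    show "rank_bounded d X G B"
      using rank B(1) by (auto simp: rank_bounded_def)
    show "convex C"
    proof (rule convexI)
      fix x y :: 'a and u w :: real
      assume *: "x \<in> C" "y \<in> C" "0 \<le> u" "0 \<le> w" "u + w = 1"
      then have X: "x \<in> X" "y \<in> X" by (auto simp: C_def)
      have "f (u *\<^sub>R x + w *\<^sub>R y) \<le> u * f x + w * f y"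
        using convex_f * X by (auto simp: convex_on_def)
      also have "\<dots> < v" using * by (intro convex_bound_lt) (auto simp: C_def)
      finally show "u *\<^sub>R x + w *\<^sub>R y \<in> C"
        using convexD[OF convex_X X] * by (simp add: C_def)
    qed
    show "convex_on UNIV (\<lambda>x. G x k)" if "k \<in> B" for k
    proof -
      have "G x k = q x (z k) + \<rho> * \<theta> k" for x using q[of k x] that B by auto
      then show ?thesis
        using convex_on_add[OF convex_q convex_on_const[THEN iffD2, OF convex_UNIV],
            of "z k" "\<rho> * \<theta> k"] by simp
    qed
    show "G (p j) k \<le> \<rho> * \<theta> k" if "j \<in> B" "k \<in> B" "j \<noteq> k" for j k
    proof -
      have "q (p j) (z k) \<le> 0" using p[OF that(1)] that by (auto simp: feas_def)
      then show ?thesis using q[of k "p j"] that B by auto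
    qed
    show "\<exists>k\<in>B. \<rho> * \<theta> k < G x k" if x: "x \<in> C" for x
    proof (rule ccontr)
      assume "\<not> ?thesis"
      then have "q x (z k) \<le> 0" if "k \<in> B" for k using q[of k x] B that by force
      then have "x \<in> feas (z ` B)" using x by (auto simp: feas_def C_def)
      then show False using val_le[of x "z ` B"] B x by (auto simp: C_def)
    qed
  qed (use finB p \<theta> B \<rho> in \<open>auto simp: C_def\<close>)
  then show ?thesis using B by (auto simp: v_def)
qed

text \<open>From the minimiser under the tight constraint one moves a little towards the minimiser
  for \<open>S\<close> alone, whose objective is strictly smaller; the relaxation by
  \<open>e\<close> leaves room for this step. This is what makes the value strictly monotone in a
  label whose constraint is essential.\<close>

lemma val_strict_of_relaxation:
  assumes e: "e > 0" "\<And>x. q x z2 = q x z1 - e"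
    and less: "val S < val (insert z2 S)" and T: "val (insert z1 S) < T"
  shows "val (insert z2 S) < val (insert z1 S)"
proof -
  obtain x1 where x1: "x1 \<in> feas (insert z1 S)" "f x1 = val (insert z1 S)"
    using T val_less_T_iff val_attained by metis
  have "feas S \<noteq> {}" using less val_less_T_iff val_le_T[of "insert z2 S"] by fastforce
  then obtain y where y: "y \<in> feas S" "f y = val S" by (rule val_attained)
  have X: "x1 \<in> X" "y \<in> X" using x1 y by (auto simp: feas_def)
  have "val (insert z2 S) \<le> f x1"
    using x1 e by (intro val_le) (force simp: feas_def)
  then have fy: "f y < f x1" using y less by simp
  define a where "a = max 0 (q y z2)"
  \<comment> \<open>The largest step for which convexity still guarantees the relaxed constraint: it
    solves \<open>u * a = (1 - u) * e\<close>.\<close>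
  define u where "u = e / (a + e)"
  have u: "0 < u" "u \<le> 1" "u * a = (1 - u) * e"
    using e by (auto simp: u_def a_def field_simps)
  define x where "x = (1 - u) *\<^sub>R x1 + u *\<^sub>R y"
  have q_le: "q x z' \<le> (1 - u) * q x1 z' + u * q y z'" for z'
    unfolding x_def using convex_onD[OF convex_q[of z'], of u x1 y] u by simp
  have "q x z' \<le> 0" if "z' \<in> S" for z'
  proof -
    have "q x1 z' \<le> 0" "q y z' \<le> 0" using x1 y that by (auto simp: feas_def)
    then have "(1 - u) * q x1 z' \<le> 0" "u * q y z' \<le> 0"
      using u by (auto intro!: mult_nonneg_nonpos)
    then show ?thesis using q_le[of z'] by linarith
  qed
  moreover have "q x z2 \<le> 0"
  proof -
    have "q x1 z2 \<le> - e" using x1 e by (simp add: feas_def)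
    then have "(1 - u) * q x1 z2 \<le> (1 - u) * (- e)" using u by (intro mult_left_mono) auto
    moreover have "u * q y z2 \<le> u * a" using u by (intro mult_left_mono) (auto simp: a_def)
    ultimately show ?thesis using q_le[of z2] u(3) by simp
  qed
  moreover have "x \<in> X"
    unfolding x_def using X u convex_X by (auto simp: convex_alt)
  ultimately have "x \<in> feas (insert z2 S)" by (auto simp: feas_def)
  then have "val (insert z2 S) \<le> f x" by (rule val_le)
  also have "f x \<le> (1 - u) * f x1 + u * f y"
    unfolding x_def using convex_onD[OF convex_f, of u x1 y] u X by simp
  also have "\<dots> < f x1"
  proof -
    have "u * f y < u * f x1" using fy u by simp
    then show ?thesis by (simp add: algebra_simps)
  qed
  finally show ?thesis using x1 by simp
qed

end

locale strictly_convex_program = convex_program +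
  assumes midpoint: "\<And>x y. x \<in> X \<Longrightarrow> y \<in> X \<Longrightarrow> x \<noteq> y \<Longrightarrow>
      f ((1/2) *\<^sub>R x + (1/2) *\<^sub>R y) < (f x + f y) / 2"
begin

lemma minimizer_unique:
  assumes "x \<in> feas S" "y \<in> feas S" "f x = val S" "f y = val S"
  shows "x = y"
proof (rule ccontr)
  assume "x \<noteq> y"
  define w where "w = (1/2) *\<^sub>R x + (1/2) *\<^sub>R y"
  have X: "x \<in> X" "y \<in> X" using assms by (auto simp: feas_def)
  have "q w z \<le> 0" if "z \<in> S" for z
  proof -
    have "q w z \<le> (1/2) * q x z + (1/2) * q y z"
      unfolding w_def using convex_onD[OF convex_q[of z], of "1/2" x y] by simp
    moreover have "q x z \<le> 0" "q y z \<le> 0" using assms that by (auto simp: feas_def)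
    ultimately show ?thesis by linarith
  qed
  moreover have "w \<in> X" unfolding w_def using X convexD[OF convex_X, of x y "1/2" "1/2"] by simp
  ultimately have "val S \<le> f w" by (intro val_le) (auto simp: feas_def)
  then show False using midpoint[OF X \<open>x \<noteq> y\<close>] assms by (simp add: w_def)
qed

text \<open>Locality comes from uniqueness: if \<open>h\<close> leaves the value unchanged, a
  minimiser with \<open>h\<close> is also one without it, hence the same point. The single minimiser
  for \<open>S\<close> thus satisfies all of \<open>H\<close> at once, whereas with a merely linear
  objective different \<open>h\<close> could be met by different minimisers.\<close>

lemma val_Un_eq:
  assumes "\<And>h. h \<in> H \<Longrightarrow> val (insert h S) = val S"
  shows "val (S \<union> H) = val S"
proof (cases "feas S = {}")
  case True
  then have "feas (S \<union> H) = {}" by (auto simp: feas_def)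
  then show ?thesis using True by (simp add: val_infeasible)
next
  case False
  then obtain x where x: "x \<in> feas S" "f x = val S" by (rule val_attained)
  have "q x h \<le> 0" if h: "h \<in> H" for h
  proof -
    have "feas (insert h S) \<noteq> {}"
      using assms[OF h] False val_less_T_iff by metis
    then obtain y where y: "y \<in> feas (insert h S)" "f y = val (insert h S)" by (rule val_attained)
    then have "y = x" using assms[OF h] x
      by (intro minimizer_unique[of _ S]) (auto simp: feas_def)
    then show ?thesis using y by (simp add: feas_def)
  qed
  then have "x \<in> feas (S \<union> H)" using x by (auto simp: feas_def)
  then show ?thesis using val_le[of x "S \<union> H"] x val_mono[of S "S \<union> H"] by simp
qed

end

text \<open>Compactness and continuity replace the uncountable union over \<open>C\<close> by
  countable operations: the minimum over \<open>C\<close> is attained and equals the infimum over a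
  countable dense subset.\<close>

lemma sets_exists_nonpos:
  fixes F :: "'a::euclidean_space \<Rightarrow> 'm \<Rightarrow> real"
  assumes C: "compact C"
    and cont: "\<And>m. m \<in> space M \<Longrightarrow> continuous_on C (\<lambda>x. F x m)"
    and meas: "\<And>x. x \<in> C \<Longrightarrow> F x \<in> borel_measurable M"
  shows "{m\<in>space M. \<exists>x\<in>C. F x m \<le> 0} \<in> sets M"
proof -
  obtain D where D: "countable D" "D \<subseteq> C" "C \<subseteq> closure D" using separable by blast
  have "(\<exists>x\<in>C. F x m \<le> 0) \<longleftrightarrow> (\<forall>n::nat. \<exists>x\<in>D. F x m < inverse (Suc n))"
    if m: "m \<in> space M" for m
  proof
    assume "\<exists>x\<in>C. F x m \<le> 0"
    then obtain x where x: "x \<in> C" "F x m \<le> 0" by blast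
    show "\<forall>n::nat. \<exists>x\<in>D. F x m < inverse (Suc n)"
    proof
      fix n :: nat
      obtain e where e: "e > 0" "\<And>y. y \<in> C \<Longrightarrow> dist y x < e \<Longrightarrow> dist (F y m) (F x m) < inverse (Suc n)"
        using cont[OF m] x(1) unfolding continuous_on_iff
        by (metis inverse_positive_iff_positive of_nat_0_less_iff zero_less_Suc)
      obtain y where "y \<in> D" "dist y x < e"
        using D(3) x(1) e(1) closure_approachable by blast
      then show "\<exists>x\<in>D. F x m < inverse (Suc n)"
        using e(2)[of y] D(2) x(2) by (intro bexI[of _ y]) (auto simp: dist_real_def)
    qed
  next
    assume R: "\<forall>n::nat. \<exists>x\<in>D. F x m < inverse (Suc n)"
    then have "C \<noteq> {}" using D(2) by auto
    from continuous_attains_inf[OF C this cont[OF m]]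
    obtain x where x: "x \<in> C" "\<And>y. y \<in> C \<Longrightarrow> F x m \<le> F y m" by blast
    have "F x m < inverse (Suc n)" for n
      using R x(2) D(2) by (meson le_less_trans subsetD)
    then have "F x m \<le> 0"
      by (metis linorder_not_le not_less_iff_gr_or_eq reals_Archimedean)
    then show "\<exists>x\<in>C. F x m \<le> 0" using x by blast
  qed
  then have "{m\<in>space M. \<exists>x\<in>C. F x m \<le> 0} =
      {m\<in>space M. \<forall>n::nat. \<exists>x\<in>D. F x m < inverse (Suc n)}" by blast
  also have "\<dots> \<in> sets M"
  proof (intro sets.sets_Collect_countable_All sets.sets_Collect_countable_Ex'[OF _ D(1)])
    fix n :: nat and x assume "x \<in> D"
    then have [measurable]: "F x \<in> borel_measurable M" using meas D(2) by auto
    show "{m\<in>space M. F x m < inverse (Suc n)} \<in> sets M" by measurable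
  qed
  finally show ?thesis .
qed

lemma (in convex_program) borel_measurable_val:
  assumes K: "finite K" and q: "\<And>x k. x \<in> X \<Longrightarrow> k \<in> K \<Longrightarrow> (\<lambda>m. q x (u k m)) \<in> borel_measurable M"
  shows "(\<lambda>m. val ((\<lambda>k. u k m) ` K)) \<in> borel_measurable M"
  unfolding borel_measurable_iff_le
proof
  fix t
  show "{m \<in> space M. val ((\<lambda>k. u k m) ` K) \<le> t} \<in> sets M"
  proof (cases "t < T")
    case False
    then have "val ((\<lambda>k. u k m) ` K) \<le> t" for m using val_le_T by (meson linorder_not_le order_trans)
    then show ?thesis by simp
  next
    case True
    \<comment> \<open>One nonnegative function collects the objective level and all constraints; it
      vanishes exactly where \<open>f x \<le> t\<close> and every constraint holds.\<close>
    define F where "F x m = max 0 (f x - t) + (\<Sum>k\<in>K. max 0 (q x (u k m)))" for x m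
    have "F x m \<le> 0 \<longleftrightarrow> f x \<le> t \<and> (\<forall>k\<in>K. q x (u k m) \<le> 0)" for x m
    proof -
      have "F x m \<le> 0 \<longleftrightarrow> max 0 (f x - t) = 0 \<and> (\<Sum>k\<in>K. max 0 (q x (u k m))) = 0"
        using sum_nonneg[of K "\<lambda>k. max 0 (q x (u k m))"] unfolding F_def
        by (smt (verit) max.cobounded1)
      also have "\<dots> \<longleftrightarrow> f x \<le> t \<and> (\<forall>k\<in>K. q x (u k m) \<le> 0)"
        using K by (subst sum_nonneg_eq_0_iff) (auto simp: max_def)
      finally show ?thesis .
    qed
    then have "{m \<in> space M. val ((\<lambda>k. u k m) ` K) \<le> t} = {m \<in> space M. \<exists>x\<in>X. F x m \<le> 0}"
      using True by (auto simp: val_le_iff feas_def)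
    also have "\<dots> \<in> sets M"
      unfolding F_def using q
      by (intro sets_exists_nonpos compact_X continuous_intros cont_f cont_q) auto
    finally show ?thesis .
  qed
qed

section \<open>Moments and tails of the beta distribution\<close>

text \<open>Differentiation telescopes as \<open>d\<close> grows. For \<open>d \<ge> 1\<close> the
  derivative is the density of the beta law with parameters \<open>N - d + 1\<close> and
  \<open>d\<close>; the variable \<open>s\<close> stands for \<open>1 - \<epsilon>\<close>.\<close>

lemma binomial_sum_has_derivative:
  assumes "d \<le> N"
  shows "((\<lambda>s::real. \<Sum>j<d. real (N choose j) * (1 - s) ^ j * s ^ (N - j)) has_real_derivative
           real d * real (N choose d) * (1 - s) ^ (d - 1) * s ^ (N - d)) (at s)"
  using assms
proof (induction d)
  case (Suc d)
  have absorb: "real (Suc d) * real (N choose Suc d) = real (N - d) * real (N choose d)"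
    unfolding of_nat_mult[symmetric] binomial_absorption binomial_absorb_comp ..
  have "((\<lambda>s. real (N choose d) * (1 - s) ^ d * s ^ (N - d)) has_real_derivative
     real (N choose d) * (real (N - d) * (1 - s) ^ d * s ^ (N - Suc d) - real d * (1 - s) ^ (d - 1) * s ^ (N - d))) (at s)"
    by (auto intro!: derivative_eq_intros simp: algebra_simps)
  from DERIV_add[OF Suc.IH this] Suc.prems
  have "((\<lambda>s. \<Sum>j<Suc d. real (N choose j) * (1 - s) ^ j * s ^ (N - j)) has_real_derivative
     real (N - d) * real (N choose d) * (1 - s) ^ d * s ^ (N - Suc d)) (at s)"
    by (simp add: algebra_simps)
  then show ?case unfolding absorb by simp
qed simp

lemma binomial_sum_has_integral:
  assumes "d \<le> N" "0 \<le> s"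
  shows "((\<lambda>u. u ^ (N - d) * (real d * (1 - u) ^ (d - 1))) has_integral
          (\<Sum>j<d. real (N choose j) * (1 - s) ^ j * s ^ (N - j)) / real (N choose d)) {0..s}"
proof -
  let ?B = "\<lambda>s::real. \<Sum>j<d. real (N choose j) * (1 - s) ^ j * s ^ (N - j)"
  have "((\<lambda>u. real d * real (N choose d) * (1 - u) ^ (d - 1) * u ^ (N - d)) has_integral (?B s - ?B 0)) {0..s}"
  proof (rule fundamental_theorem_of_calculus[OF assms(2)])
    fix x assume "x \<in> {0..s}"
    show "(?B has_vector_derivative real d * real (N choose d) * (1 - x) ^ (d - 1) * x ^ (N - d)) (at x within {0..s})"
      using has_field_derivative_at_within[OF binomial_sum_has_derivative[OF assms(1)]]
      by (simp add: has_real_derivative_iff_has_vector_derivative)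
  qed
  moreover have "?B 0 = 0" using assms by (intro sum.neutral) auto
  ultimately have "((\<lambda>u. (1 / real (N choose d)) * (real d * real (N choose d) * (1 - u) ^ (d - 1) * u ^ (N - d)))
      has_integral ((1 / real (N choose d)) * ?B s)) {0..s}"
    by (intro has_integral_mult_right) simp
  moreover have "(1 / real (N choose d)) * (real d * real (N choose d) * (1 - u) ^ (d - 1) * u ^ (N - d)) =
      u ^ (N - d) * (real d * (1 - u) ^ (d - 1))" for u :: real
    using assms zero_less_binomial[of d N] by (simp add: field_simps)
  ultimately show ?thesis by simp
qed

text \<open>These are the moments of the beta law with parameters 1 and \<open>d\<close>: the
  binomial sum for \<open>m + d\<close> trials at \<open>s = 1\<close>, where only the term
  \<open>j = 0\<close> survives.\<close>

lemma beta_moment_integral: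
  assumes "d \<ge> 1"
  shows "((\<lambda>u. u ^ m * (real d * (1 - u) ^ (d - 1))) has_integral 1 / real ((m + d) choose d)) {0..1::real}"
proof -
  have "(\<Sum>j<d. real ((m + d) choose j) * (1 - 1) ^ j * 1 ^ (m + d - j)) =
      (\<Sum>j<d. if j = 0 then 1 else (0::real))"
    by (intro sum.cong) auto
  then have "(\<Sum>j<d. real ((m + d) choose j) * (1 - 1) ^ j * 1 ^ (m + d - j)) = (1::real)"
    using assms by (simp add: sum.delta)
  then show ?thesis using binomial_sum_has_integral[of d "m + d" 1] by simp
qed

text \<open>A law on a compact interval is determined by its moments, since polynomials approximate
  continuous functions uniformly there. Both integrals lie within \<open>e\<close> of the common
  value for an approximating polynomial.\<close>

lemma integral_eq_if_beta_moments:
  fixes \<mu> :: "real measure" and f :: "real \<Rightarrow> real"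
  assumes "prob_space \<mu>" and sets: "sets \<mu> = sets borel" and supp: "AE u in \<mu>. u \<in> {0..1}"
    and d: "d \<ge> 1" and mom: "\<And>m. (\<integral>u. u ^ m \<partial>\<mu>) = 1 / real ((m + d) choose d)"
    and f: "continuous_on UNIV f"
  shows "(\<integral>u. f u \<partial>\<mu>) = integral {0..1} (\<lambda>u. f u * (real d * (1 - u) ^ (d - 1)))"
proof -
  interpret prob_space \<mu> by fact
  define w where "w u = real d * (1 - u) ^ (d - 1)" for u :: real
  have w: "(w has_integral 1) {0..1}"
    using beta_moment_integral[OF d, of 0] by (simp add: w_def[abs_def])
  have cont_w: "continuous_on S w" for S unfolding w_def by (intro continuous_intros)
  have w_nonneg: "w u \<ge> 0" if "u \<in> {0..1}" for u using that by (simp add: w_def)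
  have intg: "integrable \<mu> h" if h: "continuous_on UNIV h" for h :: "real \<Rightarrow> real"
  proof -
    have "compact (h ` {0..1})"
      using h by (intro compact_continuous_image) (auto intro: continuous_on_subset)
    then obtain B where "\<And>u. u \<in> {0..1} \<Longrightarrow> norm (h u) \<le> B"
      using compact_imp_bounded bounded_iff by (metis image_eqI)
    then show ?thesis
      using supp h sets by (intro integrable_const_bound[of _ B])
        (auto intro: borel_measurable_continuous_onI cong: measurable_cong_sets)
  qed
  have intw: "(\<lambda>u. h u * w u) integrable_on {0..1}" if "continuous_on UNIV h" for h :: "real \<Rightarrow> real"
    using that by (intro integrable_continuous_real continuous_intros cont_w) (auto intro: continuous_on_subset)
  have approx: "\<bar>(\<integral>u. f u \<partial>\<mu>) - integral {0..1} (\<lambda>u. f u * w u)\<bar> \<le> 2 * e" if e: "e > 0" for e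
  proof -
    obtain p where p: "real_polynomial_function p" "\<And>u. u \<in> {0..1} \<Longrightarrow> \<bar>f u - p u\<bar> < e"
      using Stone_Weierstrass_real_polynomial_function[OF compact_Icc _ e, of 0 1 f] f
      by (metis continuous_on_subset subset_UNIV)
    obtain a n where p_eq: "p = (\<lambda>u. \<Sum>i\<le>n. a i * u ^ i)"
      using p(1) real_polynomial_function_iff_sum by metis
    have cont_p: "continuous_on UNIV p" unfolding p_eq by (intro continuous_intros)
    have "(\<integral>u. p u \<partial>\<mu>) = (\<Sum>i\<le>n. a i * (1 / real ((i + d) choose d)))"
    proof -
      have "(\<integral>u. p u \<partial>\<mu>) = (\<Sum>i\<le>n. (\<integral>u. a i * u ^ i \<partial>\<mu>))"
        unfolding p_eq by (intro Bochner_Integration.integral_sum intg continuous_intros)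
      then show ?thesis by (simp add: mom)
    qed
    moreover have "((\<lambda>u. p u * w u) has_integral (\<Sum>i\<le>n. a i * (1 / real ((i + d) choose d)))) {0..1}"
    proof -
      have "((\<lambda>u. \<Sum>i\<le>n. a i * (u ^ i * w u)) has_integral (\<Sum>i\<le>n. a i * (1 / real ((i + d) choose d)))) {0..1}"
        unfolding w_def by (intro has_integral_sum has_integral_mult_right beta_moment_integral d) auto
      then show ?thesis by (simp add: p_eq sum_distrib_right mult.assoc)
    qed
    ultimately have eq: "(\<integral>u. p u \<partial>\<mu>) = integral {0..1} (\<lambda>u. p u * w u)"
      by (simp add: integral_unique)
    have "\<bar>(\<integral>u. f u \<partial>\<mu>) - (\<integral>u. p u \<partial>\<mu>)\<bar> = \<bar>\<integral>u. f u - p u \<partial>\<mu>\<bar>"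
      using intg f cont_p by simp
    also have "\<dots> \<le> (\<integral>u. \<bar>f u - p u\<bar> \<partial>\<mu>)" by (rule integral_abs_bound)
    also have "\<dots> \<le> (\<integral>u. e \<partial>\<mu>)"
    proof (rule integral_mono_AE)
      show "AE u in \<mu>. \<bar>f u - p u\<bar> \<le> e"
        using supp by eventually_elim (use p(2) in \<open>auto intro: less_imp_le\<close>)
    qed (use f cont_p in \<open>auto intro!: intg continuous_intros\<close>)
    also have "\<dots> = e" by (simp add: prob_space)
    finally have 1: "\<bar>(\<integral>u. f u \<partial>\<mu>) - (\<integral>u. p u \<partial>\<mu>)\<bar> \<le> e" .
    have "integral {0..1} (\<lambda>u. f u * w u) - integral {0..1} (\<lambda>u. p u * w u) =
        integral {0..1} (\<lambda>u. (f u - p u) * w u)"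
      using intw[OF f] intw[OF cont_p] by (simp add: algebra_simps flip: Henstock_Kurzweil_Integration.integral_diff)
    also have "norm \<dots> \<le> integral {0..1} (\<lambda>u. e * w u)"
    proof (rule integral_norm_bound_integral)
      show "(\<lambda>u. (f u - p u) * w u) integrable_on {0..1}"
        using f cont_p by (intro intw continuous_intros)
      show "(\<lambda>u. e * w u) integrable_on {0..1}" by (intro intw continuous_intros)
      show "norm ((f u - p u) * w u) \<le> e * w u" if "u \<in> {0..1}" for u
        using p(2)[OF that] w_nonneg[OF that] by (simp add: abs_mult mult_right_mono)
    qed
    also have "\<dots> = e" using w by (simp add: integral_unique)
    finally have 2: "\<bar>integral {0..1} (\<lambda>u. f u * w u) - integral {0..1} (\<lambda>u. p u * w u)\<bar> \<le> e" by simp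
    show ?thesis using 1 2 eq by linarith
  qed
  have "\<bar>(\<integral>u. f u \<partial>\<mu>) - integral {0..1} (\<lambda>u. f u * w u)\<bar> \<le> 0"
  proof (rule field_le_epsilon)
    fix e :: real assume "e > 0"
    then show "\<bar>(\<integral>u. f u \<partial>\<mu>) - integral {0..1} (\<lambda>u. f u * w u)\<bar> \<le> 0 + e"
      using approx[of "e / 2"] by simp
  qed
  then show ?thesis by (simp add: w_def)
qed

text \<open>The moments control continuous test functions only, so the indicator of
  \<open>{..<s}\<close> is dominated by a ramp that falls from 1 to 0 over width \<open>e\<close>,
  and then \<open>e\<close> tends to 0. The condition \<open>s < 1\<close> keeps the ramp inside the
  unit interval.\<close>

lemma beta_moments_tail_bound:
  fixes \<mu> :: "real measure"
  assumes "prob_space \<mu>" and sets: "sets \<mu> = sets borel" and supp: "AE u in \<mu>. u \<in> {0..1}"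
    and d: "d \<ge> 1" and mom: "\<And>m. (\<integral>u. u ^ m \<partial>\<mu>) = 1 / real ((m + d) choose d)"
    and N: "d \<le> N" and s: "0 \<le> s" "s < 1"
  shows "real (N choose d) * (\<integral>u. indicator {..<s} u * u ^ (N - d) \<partial>\<mu>)
      \<le> (\<Sum>j<d. real (N choose j) * (1 - s) ^ j * s ^ (N - j))"
proof -
  interpret prob_space \<mu> by fact
  define B where "B s = (\<Sum>j<d. real (N choose j) * (1 - s) ^ j * s ^ (N - j))" for s :: real
  define I where "I = (\<integral>u. indicator {..<s} u * u ^ (N - d) \<partial>\<mu>)"
  have bound: "real (N choose d) * I \<le> B (s + e)" if e: "0 < e" "e < 1 - s" for e
  proof -
    define f where "f u = max 0 (min 1 (1 - (u - s) / e)) * u ^ (N - d)" for u :: real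
    define w where "w u = real d * (1 - u) ^ (d - 1)" for u :: real
    have cont: "continuous_on UNIV f" unfolding f_def by (intro continuous_intros) (use e in auto)
    have w_nonneg: "w u \<ge> 0" if "u \<in> {0..1}" for u using that by (simp add: w_def)
    have [measurable]: "f \<in> borel_measurable \<mu>"
      using borel_measurable_continuous_onI[OF cont] sets by (simp cong: measurable_cong_sets)
    have [measurable]: "(\<lambda>u. indicator {..<s} u * u ^ (N - d)) \<in> borel_measurable \<mu>"
      unfolding measurable_cong_sets[OF sets refl] by measurable
    have f01: "\<bar>f u\<bar> \<le> 1" if "u \<in> {0..1}" for u
      using that unfolding f_def by (simp add: abs_mult mult_le_one power_le_one)
    have "I \<le> (\<integral>u. f u \<partial>\<mu>)"
      unfolding I_def
    proof (rule integral_mono_AE)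
      show "integrable \<mu> f"
        using eventually_mono[OF supp f01] by (intro integrable_const_bound[of _ 1]) simp_all
      show "integrable \<mu> (\<lambda>u. indicator {..<s} u * u ^ (N - d))"
      proof (rule integrable_const_bound[of _ 1])
        show "AE u in \<mu>. norm (indicator {..<s} u * u ^ (N - d)) \<le> 1"
          using supp by eventually_elim (auto simp: indicator_def power_le_one)
      qed simp
      show "AE u in \<mu>. indicator {..<s} u * u ^ (N - d) \<le> f u"
        using supp
      proof eventually_elim
        case (elim u)
        have "indicator {..<s} u \<le> max 0 (min 1 (1 - (u - s) / e))"
          using e by (auto simp: indicator_def divide_nonpos_pos)
        then show ?case unfolding f_def using elim by (intro mult_right_mono) auto
      qed
    qed
    also have "\<dots> = integral {0..1} (\<lambda>u. f u * w u)"
      unfolding w_def by (rule integral_eq_if_beta_moments[OF assms(1-5) cont])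
    also have "\<dots> = integral {0..1} (\<lambda>u. if u \<in> {0..s + e} then f u * w u else 0)"
      using e by (intro integral_cong) (auto simp: f_def field_simps)
    also have "\<dots> = integral {0..s + e} (\<lambda>u. f u * w u)"
    proof -
      have "{0..s + e} \<inter> {0..1} = {0..s + e}" using e by auto
      then show ?thesis
        using Henstock_Kurzweil_Integration.integral_restrict_Int[of "{0..1}" "{0..s + e}" "\<lambda>u. f u * w u"]
        by (simp only:)
    qed
    also have "\<dots> \<le> integral {0..s + e} (\<lambda>u. u ^ (N - d) * w u)"
    proof (rule integral_le)
      show "(\<lambda>u. f u * w u) integrable_on {0..s + e}"
        using cont unfolding w_def
        by (intro integrable_continuous_real continuous_intros) (auto intro: continuous_on_subset)
      show "(\<lambda>u. u ^ (N - d) * w u) integrable_on {0..s + e}"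
        unfolding w_def by (intro integrable_continuous_real continuous_intros)
      show "f u * w u \<le> u ^ (N - d) * w u" if "u \<in> {0..s + e}" for u
      proof (rule mult_right_mono)
        show "f u \<le> u ^ (N - d)"
          using that mult_right_mono[of "max 0 (min 1 (1 - (u - s) / e))" 1 "u ^ (N - d)"]
          by (auto simp: f_def)
      qed (use that e w_nonneg in auto)
    qed
    also have "\<dots> = B (s + e) / real (N choose d)"
      unfolding w_def B_def using s e
      by (intro integral_unique binomial_sum_has_integral[OF N]) auto
    finally show ?thesis using zero_less_binomial[OF N] by (simp add: field_simps)
  qed
  have "isCont B s" unfolding B_def by (intro continuous_intros)
  then have "(\<lambda>e. B (s + e)) \<midarrow>0\<rightarrow> B s"
    using LIM_isCont_iff isCont_def by blast
  then have "((\<lambda>e. B (s + e)) \<longlongrightarrow> B s) (at_right 0)"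
    by (rule filterlim_mono[OF _ order_refl at_le]) simp
  moreover have "eventually (\<lambda>e. real (N choose d) * I \<le> B (s + e)) (at_right 0)"
    using s bound by (intro eventually_at_rightI[of 0 "1 - s"]) auto
  ultimately have "real (N choose d) * I \<le> B s"
    by (intro tendsto_lowerbound) auto
  then show ?thesis by (simp add: I_def B_def)
qed

section \<open>Unique compression schemes\<close>

\<comment> \<open>keeps \<open>{1..N}\<close> from being rewritten to \<open>{Suc 0..N}\<close>\<close>
declare One_nat_def [simp del]

text \<open>\<open>miss I x h\<close> says that the sample \<open>h\<close> disagrees with the samples \<open>x i\<close> for
  \<open>i \<in> I\<close>. That each \<open>j\<close> outside \<open>I\<close> is tested separately makes
  the tests independent given \<open>x\<close>.\<close>

locale unique_compression = prob_space Q for Q :: "'e measure" +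
  fixes d :: nat and miss :: "nat set \<Rightarrow> (nat \<Rightarrow> 'e) \<Rightarrow> 'e \<Rightarrow> bool"
  assumes d_pos: "d \<ge> 1"
    and sets_miss: "\<And>I. finite I \<Longrightarrow> card I = d \<Longrightarrow>
      {p \<in> space (Pi\<^sub>M I (\<lambda>_. Q) \<Otimes>\<^sub>M Q). miss I (fst p) (snd p)} \<in> sets (Pi\<^sub>M I (\<lambda>_. Q) \<Otimes>\<^sub>M Q)"
    and miss_cong: "\<And>I x y h. (\<And>i. i \<in> I \<Longrightarrow> x i = y i) \<Longrightarrow> miss I x h = miss I y h"
    and miss_reindex: "\<And>\<pi> I J x h. bij_betw \<pi> I J \<Longrightarrow> miss I (\<lambda>i. x (\<pi> i)) h = miss J x h"
    and unique_pinned: "\<And>N. N \<ge> d \<Longrightarrow> AE z in Pi\<^sub>M {1..N} (\<lambda>_. Q).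
      \<exists>!I. I \<subseteq> {1..N} \<and> card I = d \<and> (\<forall>j\<in>{1..N} - I. \<not> miss I z (z j))"
begin

definition agree :: "nat set \<Rightarrow> (nat \<Rightarrow> 'e) \<Rightarrow> real" where
  "agree I x = prob {h\<in>space Q. \<not> miss I x h}"

definition pinned :: "nat \<Rightarrow> nat set \<Rightarrow> (nat \<Rightarrow> 'e) \<Rightarrow> bool" where
  "pinned N I z \<longleftrightarrow> (\<forall>j\<in>{1..N} - I. \<not> miss I z (z j))"

abbreviation candidates :: "nat \<Rightarrow> nat set set" where
  "candidates N \<equiv> {I. I \<subseteq> {1..N} \<and> card I = d}"

lemma pred_miss: "finite I \<Longrightarrow> card I = d \<Longrightarrow>
    Measurable.pred (Pi\<^sub>M I (\<lambda>_. Q) \<Otimes>\<^sub>M Q) (\<lambda>p. miss I (fst p) (snd p))"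
  using sets_miss by (simp add: pred_def)

lemma pred_miss_section:
  assumes "finite I" "card I = d" "x \<in> space (Pi\<^sub>M I (\<lambda>_. Q))"
  shows "Measurable.pred Q (miss I x)"
proof -
  have "(\<lambda>h. (x, h)) \<in> Q \<rightarrow>\<^sub>M Pi\<^sub>M I (\<lambda>_. Q) \<Otimes>\<^sub>M Q"
    using assms by measurable
  from measurable_compose[OF this pred_miss[OF assms(1,2)]] show ?thesis by simp
qed

lemma pred_miss_component:
  assumes "I \<subseteq> K" "finite K" "card I = d" "j \<in> K"
  shows "Measurable.pred (Pi\<^sub>M K (\<lambda>_. Q)) (\<lambda>z. miss I z (z j))"
proof -
  have fin: "finite I" using assms finite_subset by auto
  have meas: "(\<lambda>z. (restrict z I, z j)) \<in> Pi\<^sub>M K (\<lambda>_. Q) \<rightarrow>\<^sub>M Pi\<^sub>M I (\<lambda>_. Q) \<Otimes>\<^sub>M Q"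
    using assms by (intro measurable_Pair measurable_restrict_subset measurable_component_singleton)
  have "miss I (restrict z I) h = miss I z h" for z h by (rule miss_cong) simp
  then show ?thesis
    using measurable_compose[OF meas pred_miss[OF fin assms(3)]] by (simp only: fst_conv snd_conv)
qed

lemma agree_cong: "(\<And>i. i \<in> I \<Longrightarrow> x i = y i) \<Longrightarrow> agree I x = agree I y"
  unfolding agree_def using miss_cong[of I x y] by simp

lemma agree_reindex: "bij_betw \<pi> I J \<Longrightarrow> agree I (\<lambda>i. x (\<pi> i)) = agree J x"
  unfolding agree_def by (simp add: miss_reindex)

lemma agree_01: "0 \<le> agree I x" "agree I x \<le> 1"
  by (simp_all add: agree_def)

lemma measurable_agree:
  assumes "finite I" "card I = d"
  shows "agree I \<in> borel_measurable (Pi\<^sub>M I (\<lambda>_. Q))"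
proof -
  define S where "S = {p \<in> space (Pi\<^sub>M I (\<lambda>_. Q) \<Otimes>\<^sub>M Q). \<not> miss I (fst p) (snd p)}"
  have "S \<in> sets (Pi\<^sub>M I (\<lambda>_. Q) \<Otimes>\<^sub>M Q)"
    unfolding S_def using pred_miss[OF assms] by measurable
  from finite_measure_cut_measurable[OF this]
  have "(\<lambda>x. measure Q (Pair x -` S)) \<in> borel_measurable (Pi\<^sub>M I (\<lambda>_. Q))"
    unfolding measure_def by (rule borel_measurable_enn2real)
  moreover have "measure Q (Pair x -` S) = agree I x" if "x \<in> space (Pi\<^sub>M I (\<lambda>_. Q))" for x
    using that unfolding agree_def S_def
    by (intro arg_cong[of _ _ "measure Q"]) (auto simp: space_pair_measure)
  ultimately show ?thesis by (simp cong: measurable_cong)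
qed

lemma measurable_agree_subset:
  assumes "I \<subseteq> K" "finite K" "card I = d"
  shows "agree I \<in> borel_measurable (Pi\<^sub>M K (\<lambda>_. Q))"
proof -
  have fin: "finite I" using assms finite_subset by auto
  have "(\<lambda>z. agree I (restrict z I)) \<in> borel_measurable (Pi\<^sub>M K (\<lambda>_. Q))"
    using measurable_compose[OF measurable_restrict_subset[OF assms(1)] measurable_agree[OF fin assms(3)]] .
  moreover have "agree I (restrict z I) = agree I z" for z by (rule agree_cong) simp
  ultimately show ?thesis by simp
qed

lemma pred_pinned:
  assumes "I \<in> candidates N"
  shows "Measurable.pred (Pi\<^sub>M {1..N} (\<lambda>_. Q)) (pinned N I)"
proof -
  have "Measurable.pred (Pi\<^sub>M {1..N} (\<lambda>_. Q)) (\<lambda>z. \<forall>j\<in>{1..N} - I. \<not> miss I z (z j))"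
    using assms by (intro pred_intros_finite pred_intros_logic pred_miss_component) auto
  then show ?thesis by (simp add: pinned_def[abs_def])
qed

text \<open>Given the samples in \<open>I\<close>, the \<open>N - d\<close> tests outside
  \<open>I\<close> are independent and each is passed with probability \<open>agree I x\<close>,
  which produces the power. The factor \<open>f\<close> covers both the total mass and the lower
  tail of \<open>agree\<close>.\<close>

lemma nn_integral_pinned:
  assumes I: "I \<in> candidates N" and [measurable]: "f \<in> borel_measurable borel"
  shows "(\<integral>\<^sup>+z. (if pinned N I z then f (agree I z) else 0) \<partial>Pi\<^sub>M {1..N} (\<lambda>_. Q)) =
    (\<integral>\<^sup>+x. f (agree I x) * ennreal (agree I x ^ (N - d)) \<partial>Pi\<^sub>M I (\<lambda>_. Q))"
proof -
  interpret product_sigma_finite "\<lambda>_::nat. Q" ..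
  define J where "J = {1..N} - I"
  have IJ: "{1..N} = I \<union> J" "I \<inter> J = {}" "finite I" "finite J" "card J = N - d"
    using I finite_subset[of I "{1..N}"] by (auto simp: J_def card_Diff_subset)
  have card: "card I = d" using I by simp
  note [measurable] = pred_pinned[OF I]
  have [measurable]: "agree I \<in> borel_measurable (Pi\<^sub>M {1..N} (\<lambda>_. Q))"
    using I by (intro measurable_agree_subset) auto
  have "(\<integral>\<^sup>+z. (if pinned N I z then f (agree I z) else 0) \<partial>Pi\<^sub>M {1..N} (\<lambda>_. Q)) =
    (\<integral>\<^sup>+x. (\<integral>\<^sup>+y. (if pinned N I (merge I J (x, y)) then f (agree I (merge I J (x, y))) else 0)
        \<partial>Pi\<^sub>M J (\<lambda>_. Q)) \<partial>Pi\<^sub>M I (\<lambda>_. Q))"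
  proof -
    have "(\<lambda>z. if pinned N I z then f (agree I z) else 0) \<in> borel_measurable (Pi\<^sub>M (I \<union> J) (\<lambda>_. Q))"
      unfolding IJ(1)[symmetric] by measurable
    from product_nn_integral_fold[OF IJ(2-4) this] show ?thesis by (simp only: IJ(1))
  qed
  also have "\<dots> = (\<integral>\<^sup>+x. f (agree I x) * ennreal (agree I x ^ (N - d)) \<partial>Pi\<^sub>M I (\<lambda>_. Q))"
  proof (rule nn_integral_cong)
    fix x assume x: "x \<in> space (Pi\<^sub>M I (\<lambda>_. Q))"
    define g where "g h = (if miss I x h then 0 else 1 :: ennreal)" for h
    note [measurable] = pred_miss_section[OF IJ(3) card x]
    have g[measurable]: "g \<in> borel_measurable Q" unfolding g_def by measurable
    have "(if pinned N I (merge I J (x, y)) then f (agree I (merge I J (x, y))) else 0) =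
        f (agree I x) * (\<Prod>j\<in>J. g (y j))" for y
    proof -
      have mI: "miss I (merge I J (x, y)) h = miss I x h" for h
        by (rule miss_cong) (simp add: merge_def)
      have "agree I (merge I J (x, y)) = agree I x"
        by (rule agree_cong) (simp add: merge_def)
      moreover have "pinned N I (merge I J (x, y)) \<longleftrightarrow> (\<forall>j\<in>J. \<not> miss I x (y j))"
        unfolding pinned_def mI J_def[symmetric] using IJ(2) by (auto simp: merge_def)
      moreover have "(\<Prod>j\<in>J. g (y j)) = (if \<forall>j\<in>J. \<not> miss I x (y j) then 1 else 0)"
        using IJ(4) by (auto simp: g_def intro!: prod.neutral)
      ultimately show ?thesis by simp
    qed
    then have "(\<integral>\<^sup>+y. (if pinned N I (merge I J (x, y)) then f (agree I (merge I J (x, y))) else 0)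
        \<partial>Pi\<^sub>M J (\<lambda>_. Q)) = (\<integral>\<^sup>+y. f (agree I x) * (\<Prod>j\<in>J. g (y j)) \<partial>Pi\<^sub>M J (\<lambda>_. Q))"
      by simp
    also have "\<dots> = f (agree I x) * (\<integral>\<^sup>+y. (\<Prod>j\<in>J. g (y j)) \<partial>Pi\<^sub>M J (\<lambda>_. Q))"
      using IJ(4) by (intro nn_integral_cmult borel_measurable_prod_ennreal) measurable
    also have "(\<integral>\<^sup>+y. (\<Prod>j\<in>J. g (y j)) \<partial>Pi\<^sub>M J (\<lambda>_. Q)) = (\<Prod>j\<in>J. integral\<^sup>N Q g)"
      by (rule product_nn_integral_prod[OF IJ(4)]) (rule g)
    also have "integral\<^sup>N Q g = ennreal (agree I x)"
    proof -
      have "integral\<^sup>N Q g = (\<integral>\<^sup>+h. indicator {h\<in>space Q. \<not> miss I x h} h \<partial>Q)"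
        by (intro nn_integral_cong) (auto simp: g_def)
      also have "\<dots> = emeasure Q {h\<in>space Q. \<not> miss I x h}"
        by (intro nn_integral_indicator) measurable
      finally show ?thesis by (simp add: agree_def emeasure_eq_measure)
    qed
    finally show "(\<integral>\<^sup>+y. (if pinned N I (merge I J (x, y)) then f (agree I (merge I J (x, y))) else 0)
        \<partial>Pi\<^sub>M J (\<lambda>_. Q)) = f (agree I x) * ennreal (agree I x ^ (N - d))"
      by (simp add: IJ(5) ennreal_power agree_01)
  qed
  finally show ?thesis .
qed

text \<open>By exchangeability (\<open>miss_reindex\<close>) this is the law of
  \<open>agree I\<close> for every \<open>I\<close> of size \<open>d\<close>. It does not involve
  \<open>N\<close>, so each sample size contributes one moment of the same law.\<close>

definition \<mu> :: "real measure" where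
  "\<mu> = distr (Pi\<^sub>M {1..d} (\<lambda>_. Q)) borel (agree {1..d})"

lemma nn_integral_agree:
  assumes I: "finite I" "card I = d" and [measurable]: "f \<in> borel_measurable borel"
  shows "(\<integral>\<^sup>+x. f (agree I x) \<partial>Pi\<^sub>M I (\<lambda>_. Q)) = (\<integral>\<^sup>+u. f u \<partial>\<mu>)"
proof -
  obtain \<pi> where \<pi>: "bij_betw \<pi> {1..d} I"
    using I finite_same_card_bij[of "{1..d}" I] by auto
  have [measurable]: "agree {1..d} \<in> borel_measurable (Pi\<^sub>M {1..d} (\<lambda>_. Q))"
    by (rule measurable_agree) auto
  have [measurable]: "(\<lambda>x. \<lambda>n\<in>{1..d}. x (\<pi> n)) \<in> Pi\<^sub>M I (\<lambda>_. Q) \<rightarrow>\<^sub>M Pi\<^sub>M {1..d} (\<lambda>_. Q)"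
    using \<pi> by (intro measurable_restrict measurable_component_singleton) (auto simp: bij_betw_def)
  have "(\<integral>\<^sup>+u. f u \<partial>\<mu>) = (\<integral>\<^sup>+x. f (agree {1..d} x) \<partial>Pi\<^sub>M {1..d} (\<lambda>_. Q))"
    unfolding \<mu>_def by (rule nn_integral_distr) auto
  also have "Pi\<^sub>M {1..d} (\<lambda>_. Q) =
      distr (Pi\<^sub>M I (\<lambda>_. Q)) (Pi\<^sub>M {1..d} (\<lambda>_. Q)) (\<lambda>x. \<lambda>n\<in>{1..d}. x (\<pi> n))"
    using \<pi> by (intro distr_PiM_reindex[symmetric]) (auto simp: bij_betw_def prob_space_axioms)
  also have "(\<integral>\<^sup>+x. f (agree {1..d} x) \<partial>\<dots>) =
      (\<integral>\<^sup>+x. f (agree {1..d} (\<lambda>n\<in>{1..d}. x (\<pi> n))) \<partial>Pi\<^sub>M I (\<lambda>_. Q))"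
    by (rule nn_integral_distr) auto
  also have "\<dots> = (\<integral>\<^sup>+x. f (agree I x) \<partial>Pi\<^sub>M I (\<lambda>_. Q))"
  proof -
    have "agree {1..d} (\<lambda>n\<in>{1..d}. x (\<pi> n)) = agree I x" for x
      using agree_reindex[OF \<pi>, of x] agree_cong[of "{1..d}" "\<lambda>n\<in>{1..d}. x (\<pi> n)" "\<lambda>n. x (\<pi> n)"]
      by simp
    then show ?thesis by simp
  qed
  finally show ?thesis by simp
qed

lemma prob_space_\<mu>: "prob_space \<mu>"
  unfolding \<mu>_def
  by (intro prob_space.prob_space_distr prob_space_PiM prob_space_axioms measurable_agree) auto

lemma AE_\<mu>: "AE u in \<mu>. u \<in> {0..1}"
  unfolding \<mu>_def using agree_01
  by (subst AE_distr_iff) (auto intro!: measurable_agree)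

lemma card_candidates: "card (candidates N) = N choose d" "finite (candidates N)"
  using n_subsets[of "{1..N}" d] by auto

lemma nn_integral_sum_pinned:
  assumes "f \<in> borel_measurable borel"
  shows "(\<Sum>I\<in>candidates N. \<integral>\<^sup>+z. (if pinned N I z then f (agree I z) else 0) \<partial>Pi\<^sub>M {1..N} (\<lambda>_. Q))
    = of_nat (N choose d) * (\<integral>\<^sup>+u. f u * ennreal (u ^ (N - d)) \<partial>\<mu>)"
proof -
  have "(\<integral>\<^sup>+z. (if pinned N I z then f (agree I z) else 0) \<partial>Pi\<^sub>M {1..N} (\<lambda>_. Q))
     = (\<integral>\<^sup>+u. f u * ennreal (u ^ (N - d)) \<partial>\<mu>)" if I: "I \<in> candidates N" for I
  proof -
    have "finite I" using I finite_subset[of I "{1..N}"] by auto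
    moreover have "(\<lambda>u. f u * ennreal (u ^ (N - d))) \<in> borel_measurable borel"
      using assms by measurable
    ultimately show ?thesis
      using I unfolding nn_integral_pinned[OF I assms] by (intro nn_integral_agree) auto
  qed
  then show ?thesis by (simp add: card_candidates)
qed

text \<open>Almost surely exactly one candidate is pinned, so the indicators sum to 1; integrating
  them with \<open>m + d\<close> samples equates 1 with the number of candidates times the moment.
  Only this exact equality identifies the law; a one-sided estimate would not.\<close>

lemma moments_\<mu>: "(\<integral>u. u ^ m \<partial>\<mu>) = 1 / real ((m + d) choose d)"
proof -
  let ?N = "m + d"
  let ?M = "Pi\<^sub>M {1..?N} (\<lambda>_. Q)"
  interpret M: prob_space ?M by (intro prob_space_PiM prob_space_axioms)
  interpret \<mu>: prob_space \<mu> by (rule prob_space_\<mu>)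
  have 1: "(\<Sum>I\<in>candidates ?N. if pinned ?N I z then 1 else 0) = (1::ennreal)"
    if "\<exists>!I. I \<subseteq> {1..?N} \<and> card I = d \<and> (\<forall>j\<in>{1..?N} - I. \<not> miss I z (z j))" for z
  proof -
    have "\<exists>!I. I \<in> candidates ?N \<and> pinned ?N I z"
      using that by (simp only: pinned_def mem_Collect_eq conj_assoc)
    then obtain I where I: "I \<in> candidates ?N" "pinned ?N I z"
      "\<And>I'. I' \<in> candidates ?N \<Longrightarrow> pinned ?N I' z \<Longrightarrow> I' = I"
      unfolding Ex1_def by blast
    have "(\<Sum>I'\<in>candidates ?N. if pinned ?N I' z then 1 else 0) =
        (\<Sum>I'\<in>candidates ?N. if I' = I then 1 else (0::ennreal))"
    proof (rule sum.cong[OF refl])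
      fix I' assume "I' \<in> candidates ?N"
      then have "pinned ?N I' z \<longleftrightarrow> I' = I" using I by blast
      then show "(if pinned ?N I' z then 1 else 0) = (if I' = I then 1 else (0::ennreal))" by simp
    qed
    then show ?thesis using I(1) card_candidates(2)[of ?N] by (simp add: sum.delta)
  qed
  have "1 = (\<integral>\<^sup>+z. 1 \<partial>?M)" by (simp add: M.emeasure_space_1)
  also have "\<dots> = (\<integral>\<^sup>+z. (\<Sum>I\<in>candidates ?N. if pinned ?N I z then 1 else 0) \<partial>?M)"
  proof (rule nn_integral_cong_AE)
    show "AE z in ?M. 1 = (\<Sum>I\<in>candidates ?N. if pinned ?N I z then 1 else (0::ennreal))"
      using unique_pinned[of ?N, OF le_add2] by (rule eventually_mono) (rule 1[symmetric])
  qed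
  also have "\<dots> = (\<Sum>I\<in>candidates ?N. \<integral>\<^sup>+z. (if pinned ?N I z then 1 else 0) \<partial>?M)"
    by (intro nn_integral_sum measurable_If_set) (use pred_pinned in \<open>auto simp: pred_def\<close>)
  also have "\<dots> = of_nat (?N choose d) * (\<integral>\<^sup>+u. ennreal (u ^ m) \<partial>\<mu>)"
    using nn_integral_sum_pinned[of "\<lambda>_. 1" ?N] by simp
  also have "(\<integral>\<^sup>+u. ennreal (u ^ m) \<partial>\<mu>) = ennreal (\<integral>u. u ^ m \<partial>\<mu>)"
  proof (rule nn_integral_eq_integral)
    show "integrable \<mu> (\<lambda>u. u ^ m)"
    proof (rule \<mu>.integrable_const_bound)
      show "AE u in \<mu>. norm (u ^ m) \<le> 1"
        using AE_\<mu> by eventually_elim (auto simp: power_le_one)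
      show "(\<lambda>u. u ^ m) \<in> borel_measurable \<mu>" by (simp add: \<mu>_def)
    qed
    show "AE u in \<mu>. 0 \<le> u ^ m" using AE_\<mu> by eventually_elim auto
  qed
  also have "of_nat (?N choose d) * ennreal (\<integral>u. u ^ m \<partial>\<mu>) = ennreal (real (?N choose d) * (\<integral>u. u ^ m \<partial>\<mu>))"
    by (simp add: ennreal_mult' ennreal_of_nat_eq_real_of_nat)
  finally have "real (?N choose d) * (\<integral>u. u ^ m \<partial>\<mu>) = 1"
    using ennreal_eq_1[of "real (?N choose d) * (\<integral>u. u ^ m \<partial>\<mu>)"] by simp
  then show ?thesis by (simp add: field_simps)
qed

lemma sets_exceptional:
  "{z\<in>space (Pi\<^sub>M {1..N} (\<lambda>_. Q)). \<exists>I\<in>candidates N. pinned N I z \<and> agree I z < s} \<in> sets (Pi\<^sub>M {1..N} (\<lambda>_. Q))"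
  (is "?S \<in> sets ?M")
proof -
  have S_eq: "?S = (\<Union>I\<in>candidates N. {z\<in>space ?M. pinned N I z \<and> agree I z < s})" by auto
  show ?thesis
    unfolding S_eq
  proof (intro sets.finite_UN card_candidates)
    fix I assume I: "I \<in> candidates N"
    note [measurable] = pred_pinned[OF I]
    have [measurable]: "agree I \<in> borel_measurable ?M"
      using I by (intro measurable_agree_subset) auto
    show "{z\<in>space ?M. pinned N I z \<and> agree I z < s} \<in> sets ?M" by measurable
  qed
qed

text \<open>Here \<open>s\<close> is \<open>1 - \<epsilon>\<close>. Summing over the candidates
  costs nothing, because almost surely only one of them is pinned.\<close>

theorem compression_bound:
  assumes N: "N \<ge> d" and s: "0 \<le> s" "s < 1"
  shows "emeasure (Pi\<^sub>M {1..N} (\<lambda>_. Q))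
      {z\<in>space (Pi\<^sub>M {1..N} (\<lambda>_. Q)). \<exists>I\<in>candidates N. pinned N I z \<and> agree I z < s}
    \<le> ennreal (\<Sum>j<d. real (N choose j) * (1 - s) ^ j * s ^ (N - j))" (is "emeasure ?M ?S \<le> _")
proof -
  interpret \<mu>: prob_space \<mu> by (rule prob_space_\<mu>)
  let ?f = "\<lambda>u. indicator {..<s} u :: ennreal"
  have meas: "(\<lambda>z. if pinned N I z then ?f (agree I z) else 0) \<in> borel_measurable ?M"
    if I: "I \<in> candidates N" for I
  proof -
    note [measurable] = pred_pinned[OF I]
    have [measurable]: "agree I \<in> borel_measurable ?M"
      using I by (intro measurable_agree_subset) auto
    show ?thesis by measurable
  qed
  have "?S \<in> sets ?M" by (rule sets_exceptional)
  then have "emeasure ?M ?S = (\<integral>\<^sup>+z. indicator ?S z \<partial>?M)" by simp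
  also have "\<dots> \<le> (\<integral>\<^sup>+z. (\<Sum>I\<in>candidates N. if pinned N I z then ?f (agree I z) else 0) \<partial>?M)"
  proof (rule nn_integral_mono)
    fix z
    show "indicator ?S z \<le> (\<Sum>I\<in>candidates N. if pinned N I z then ?f (agree I z) else 0)"
    proof (cases "z \<in> ?S")
      case True
      then obtain I where I: "I \<in> candidates N" "pinned N I z" "agree I z < s" by auto
      then have "1 = (if pinned N I z then ?f (agree I z) else 0)" by simp
      also have "\<dots> \<le> (\<Sum>I\<in>candidates N. if pinned N I z then ?f (agree I z) else 0)"
        using I(1) card_candidates(2) by (intro member_le_sum) auto
      finally show ?thesis using True by simp
    qed simp
  qed
  also have "\<dots> = of_nat (N choose d) * (\<integral>\<^sup>+u. ?f u * ennreal (u ^ (N - d)) \<partial>\<mu>)"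
    by (subst nn_integral_sum, erule meas) (simp add: nn_integral_sum_pinned)
  also have "(\<integral>\<^sup>+u. ?f u * ennreal (u ^ (N - d)) \<partial>\<mu>) = (\<integral>\<^sup>+u. ennreal (indicator {..<s} u * u ^ (N - d)) \<partial>\<mu>)"
    by (intro nn_integral_cong) (auto simp: indicator_def)
  also have "\<dots> = ennreal (\<integral>u. indicator {..<s} u * u ^ (N - d) \<partial>\<mu>)"
  proof (rule nn_integral_eq_integral)
    show "integrable \<mu> (\<lambda>u. indicator {..<s} u * u ^ (N - d))"
    proof (rule \<mu>.integrable_const_bound)
      show "AE u in \<mu>. norm (indicator {..<s} u * u ^ (N - d)) \<le> 1"
        using AE_\<mu> by eventually_elim (auto simp: power_le_one indicator_def)
      show "(\<lambda>u. indicator {..<s} u * u ^ (N - d)) \<in> borel_measurable \<mu>" by (simp add: \<mu>_def)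
    qed
    show "AE u in \<mu>. 0 \<le> indicator {..<s} u * u ^ (N - d)" using AE_\<mu> by eventually_elim auto
  qed
  also have "of_nat (N choose d) * \<dots> =
      ennreal (real (N choose d) * (\<integral>u. indicator {..<s} u * u ^ (N - d) \<partial>\<mu>))"
    by (simp add: ennreal_mult' ennreal_of_nat_eq_real_of_nat)
  also have "\<dots> \<le> ennreal (\<Sum>j<d. real (N choose j) * (1 - s) ^ j * s ^ (N - j))"
    using beta_moments_tail_bound[OF prob_space_\<mu> _ AE_\<mu> d_pos moments_\<mu> N s]
    by (intro ennreal_leI) (simp add: \<mu>_def)
  finally show ?thesis .
qed

end

section \<open>Scenario programs with random labels\<close>

text \<open>Fatou's lemma for sets, applied later both to the new sample and to the
  multi-sample.\<close>

lemma emeasure_le_liminf: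
  assumes S: "S \<in> sets M" and Sn: "\<And>n::nat. Sn n \<in> sets M"
    and ev: "AE x in M. x \<in> S \<longrightarrow> (\<forall>\<^sub>F n in sequentially. x \<in> Sn n)"
  shows "emeasure M S \<le> liminf (\<lambda>n. emeasure M (Sn n))"
proof -
  have "emeasure M S = (\<integral>\<^sup>+x. indicator S x \<partial>M)" using S by simp
  also have "\<dots> \<le> (\<integral>\<^sup>+x. liminf (\<lambda>n. indicator (Sn n) x) \<partial>M)"
  proof (rule nn_integral_mono_AE)
    show "AE x in M. indicator S x \<le> liminf (\<lambda>n. indicator (Sn n) x :: ennreal)"
      using ev
    proof eventually_elim
      case (elim x)
      show ?case
      proof (cases "x \<in> S")
        case True
        then have "\<forall>\<^sub>F n in sequentially. x \<in> Sn n" using elim by simp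
        then have "\<forall>\<^sub>F n in sequentially. (1::ennreal) \<le> indicator (Sn n) x"
          by eventually_elim simp
        then show ?thesis using True by (simp add: Liminf_bounded)
      qed simp
    qed
  qed
  also have "\<dots> \<le> liminf (\<lambda>n. \<integral>\<^sup>+x. indicator (Sn n) x \<partial>M)"
    using Sn by (intro nn_integral_liminf) simp
  also have "\<dots> = liminf (\<lambda>n. emeasure M (Sn n))" using Sn by simp
  finally show ?thesis .
qed

definition unif01 :: "real measure" where "unif01 = uniform_measure lborel {0..1}"

lemma prob_space_unif01: "prob_space unif01"
  unfolding unif01_def by (rule prob_space_uniform_measure) auto

lemma space_unif01 [simp]: "space unif01 = UNIV" and sets_unif01 [simp, measurable_cong]: "sets unif01 = sets borel"
  by (simp_all add: unif01_def)

lemma AE_unif01_nonneg: "AE t in unif01. 0 \<le> t"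
  unfolding unif01_def by (subst AE_uniform_measure) auto

lemma AE_unif01_if_subsingleton:
  assumes "\<And>s t. s < t \<Longrightarrow> \<not> p s \<Longrightarrow> \<not> p t \<Longrightarrow> False"
  shows "AE t in unif01. p t"
proof -
  have "AE t in unif01. t \<noteq> c" for c
    unfolding unif01_def by (subst AE_uniform_measure) (auto intro: AE_mp[OF AE_lborel_singleton])
  moreover obtain c where "\<And>t. t \<noteq> c \<Longrightarrow> p t"
    using assms by (metis linorder_neqE)
  ultimately show ?thesis by (metis (mono_tags, lifting) eventually_mono)
qed

text \<open>One \<open>T\<close> bounds the perturbed objectives for all \<rho> in the unit
  interval, so that the perturbed programs and their limit share the value of infeasibility.
  Feasibility and rank bound range over all sample sizes because every moment of the agreement law
  is needed.\<close>

locale scenario = P: prob_space P for P :: "'e measure" +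
  fixes X :: "'a::euclidean_space set" and cost :: 'a and T :: real
    and g :: "'a \<Rightarrow> 'e \<Rightarrow> real" and d :: nat
  assumes compact_X: "compact X" and convex_X: "convex X"
    and below_T: "\<And>x \<rho>. x \<in> X \<Longrightarrow> 0 \<le> \<rho> \<Longrightarrow> \<rho> \<le> 1 \<Longrightarrow> cost \<bullet> x + \<rho> * (x \<bullet> x) < T"
    and convex_g: "\<And>\<delta>. convex_on UNIV (\<lambda>x. g x \<delta>)"
    and measurable_g: "\<And>x. x \<in> X \<Longrightarrow> g x \<in> borel_measurable P"
    and feasible: "\<And>N::nat. N \<ge> 1 \<Longrightarrow> AE \<omega> in Pi\<^sub>M {1..N} (\<lambda>_. P). \<exists>x\<in>X. \<forall>j\<in>{1..N}. g x (\<omega> j) \<le> 0"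
    and rank: "\<And>N::nat. AE \<omega> in Pi\<^sub>M {1..N} (\<lambda>_. P). rank_bounded d X (\<lambda>x k. g x (\<omega> k)) {1..N}"
    and d_pos: "d \<ge> 1"
begin

definition obj :: "real \<Rightarrow> 'a \<Rightarrow> real" where "obj \<rho> x = cost \<bullet> x + \<rho> * (x \<bullet> x)"

text \<open>Every sample carries an independent uniform label \<open>snd z\<close>, which relaxes its constraint; this
  and the strictly convex objective remove all degeneracy almost surely.\<close>

definition slack :: "real \<Rightarrow> 'a \<Rightarrow> 'e \<times> real \<Rightarrow> real" where
  "slack \<rho> x z = g x (fst z) - \<rho> * snd z"

definition Q :: "('e \<times> real) measure" where "Q = P \<Otimes>\<^sub>M unif01"

abbreviation vl :: "real \<Rightarrow> ('e \<times> real) set \<Rightarrow> real" where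
  "vl \<rho> \<equiv> convex_program.val X (obj \<rho>) T (slack \<rho>)"

text \<open>Violation is a rise of the optimal value and does not refer to a minimiser: values are
  measurable in the samples, and they can be compared as \<rho> tends to 0 without following the
  minimisers.\<close>

definition viol :: "real \<Rightarrow> nat \<Rightarrow> (nat \<Rightarrow> 'e \<times> real) \<Rightarrow> 'e \<times> real \<Rightarrow> bool" where
  "viol \<rho> N z h \<longleftrightarrow> vl \<rho> (z ` {1..N}) < vl \<rho> (insert h (z ` {1..N}))"

definition miss :: "real \<Rightarrow> nat set \<Rightarrow> (nat \<Rightarrow> 'e \<times> real) \<Rightarrow> 'e \<times> real \<Rightarrow> bool" where
  "miss \<rho> I z h \<longleftrightarrow> vl \<rho> (z ` I) < vl \<rho> (insert h (z ` I)) \<or>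
     (\<exists>b\<in>I. vl \<rho> (z ` (I - {b})) = vl \<rho> (z ` I) \<and> snd h < snd (z b))"

lemma convex_obj: "0 \<le> \<rho> \<Longrightarrow> convex_on X (obj \<rho>)"
proof (rule convex_onI[OF _ convex_X])
  fix t :: real and x y assume \<rho>: "0 \<le> \<rho>" and t: "0 < t" "t < 1"
  have "(1 - t) * obj \<rho> x + t * obj \<rho> y - obj \<rho> ((1 - t) *\<^sub>R x + t *\<^sub>R y) =
      \<rho> * (t * (1 - t) * ((x - y) \<bullet> (x - y)))"
    unfolding obj_def by (simp add: inner_simps inner_commute algebra_simps power2_eq_square)
  also have "\<dots> \<ge> 0" using \<rho> t by simp
  finally show "obj \<rho> ((1 - t) *\<^sub>R x + t *\<^sub>R y) \<le> (1 - t) * obj \<rho> x + t * obj \<rho> y" by simp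
qed

lemma program: "0 \<le> \<rho> \<Longrightarrow> \<rho> \<le> 1 \<Longrightarrow> convex_program X (obj \<rho>) T (slack \<rho>)"
proof
  show "continuous_on X (obj \<rho>)" unfolding obj_def by (intro continuous_intros)
  show "convex_on UNIV (\<lambda>x. slack \<rho> x z)" for z
    using convex_on_add[OF convex_g[of "fst z"] convex_on_const[THEN iffD2, OF convex_UNIV], of "- (\<rho> * snd z)"]
    by (simp add: slack_def)
qed (simp_all add: compact_X convex_X convex_obj below_T obj_def)

lemma strict_program: "0 < \<rho> \<Longrightarrow> \<rho> \<le> 1 \<Longrightarrow> strictly_convex_program X (obj \<rho>) T (slack \<rho>)"
proof (intro strictly_convex_program.intro strictly_convex_program_axioms.intro program)
  fix x y :: 'a assume "0 < \<rho>" "x \<noteq> y"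
  have "(obj \<rho> x + obj \<rho> y) / 2 - obj \<rho> ((1/2) *\<^sub>R x + (1/2) *\<^sub>R y) =
      \<rho> * ((x - y) \<bullet> (x - y)) / 4"
    unfolding obj_def by (simp add: inner_simps inner_commute algebra_simps power2_eq_square)
  also have "\<dots> > 0" using \<open>0 < \<rho>\<close> \<open>x \<noteq> y\<close> by simp
  finally show "obj \<rho> ((1/2) *\<^sub>R x + (1/2) *\<^sub>R y) < (obj \<rho> x + obj \<rho> y) / 2" by simp
qed auto

section \<open>Measurability of the labelled programs\<close>

lemma prob_space_Q: "prob_space Q"
  unfolding Q_def by (intro prob_space_pair P.prob_space_axioms prob_space_unif01)

lemma measurable_slack:
  assumes "x \<in> X" "u \<in> M \<rightarrow>\<^sub>M Q"
  shows "(\<lambda>m. slack \<rho> x (u m)) \<in> borel_measurable M"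
proof -
  have [measurable]: "u \<in> M \<rightarrow>\<^sub>M P \<Otimes>\<^sub>M borel"
    using assms(2) unfolding Q_def by (simp cong: measurable_cong_sets sets_pair_measure_cong)
  note [measurable] = measurable_g[OF assms(1)]
  show ?thesis unfolding slack_def by measurable
qed

lemma borel_measurable_vl:
  assumes "0 \<le> \<rho>" "\<rho> \<le> 1" "finite K" "\<And>k. k \<in> K \<Longrightarrow> u k \<in> M \<rightarrow>\<^sub>M Q"
  shows "(\<lambda>m. vl \<rho> ((\<lambda>k. u k m) ` K)) \<in> borel_measurable M"
  using assms by (intro convex_program.borel_measurable_val program measurable_slack) auto

lemma borel_measurable_vl_insert:
  assumes "0 \<le> \<rho>" "\<rho> \<le> 1" "finite K" "\<And>k. k \<in> K \<Longrightarrow> u k \<in> M \<rightarrow>\<^sub>M Q" "v \<in> M \<rightarrow>\<^sub>M Q"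
  shows "(\<lambda>m. vl \<rho> (insert (v m) ((\<lambda>k. u k m) ` K))) \<in> borel_measurable M"
proof -
  have "(\<lambda>m. vl \<rho> ((\<lambda>k. (case k of None \<Rightarrow> v | Some k \<Rightarrow> u k) m) ` (insert None (Some ` K)))) \<in> borel_measurable M"
    using assms by (intro borel_measurable_vl) auto
  then show ?thesis by (simp add: image_image)
qed

lemma snd_measurable: "v \<in> M \<rightarrow>\<^sub>M Q \<Longrightarrow> (\<lambda>m. snd (v m)) \<in> borel_measurable M"
  unfolding Q_def using measurable_compose[of v M "P \<Otimes>\<^sub>M unif01" snd unif01] by (simp cong: measurable_cong_sets)

lemma component_measurable: "k \<in> K \<Longrightarrow> (\<lambda>z. z k) \<in> Pi\<^sub>M K (\<lambda>_. Q) \<rightarrow>\<^sub>M Q"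
  by (rule measurable_component_singleton)

lemma fst_component_measurable: "k \<in> K \<Longrightarrow> (\<lambda>p. fst p k) \<in> Pi\<^sub>M K (\<lambda>_. Q) \<Otimes>\<^sub>M Q \<rightarrow>\<^sub>M Q"
  by (rule measurable_compose[OF measurable_fst component_measurable])

text \<open>Fubini with the label of sample \<open>k\<close> integrated first: with everything else
  frozen, \<open>S\<close> fails for at most one label, and a single label is a null event.\<close>

lemma AE_coordinate:
  fixes K :: "nat set"
  assumes K: "finite K" "k \<in> K" and meas: "Measurable.pred (Pi\<^sub>M K (\<lambda>_. Q)) S"
    and sub: "\<And>x \<delta> s t. s < t \<Longrightarrow> \<not> S (x(k := (\<delta>, s))) \<Longrightarrow> \<not> S (x(k := (\<delta>, t))) \<Longrightarrow> False"
  shows "AE z in Pi\<^sub>M K (\<lambda>_. Q). S z"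
proof -
  interpret Q: prob_space Q by (rule prob_space_Q)
  interpret unif: prob_space unif01 by (rule prob_space_unif01)
  interpret product_sigma_finite "\<lambda>_::nat. Q" ..
  define L where "L = K - {k}"
  have KL: "K = insert k L" "k \<notin> L" "finite L" using K by (auto simp: L_def)
  define f where "f z = (if S z then 0 else 1::ennreal)" for z
  have f[measurable]: "f \<in> borel_measurable (Pi\<^sub>M (insert k L) (\<lambda>_. Q))"
    unfolding f_def using meas KL(1) by (intro measurable_If) (auto simp: pred_def)
  have "integral\<^sup>N (Pi\<^sub>M K (\<lambda>_. Q)) f = (\<integral>\<^sup>+x. (\<integral>\<^sup>+y. f (x(k := y)) \<partial>Q) \<partial>Pi\<^sub>M L (\<lambda>_. Q))"
    unfolding KL(1) by (rule product_nn_integral_insert[OF KL(3,2) f])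
  also have "\<dots> = (\<integral>\<^sup>+x. 0 \<partial>Pi\<^sub>M L (\<lambda>_. Q))"
  proof (rule nn_integral_cong)
    fix x assume x: "x \<in> space (Pi\<^sub>M L (\<lambda>_. Q))"
    have "(\<lambda>y. x(k := y)) \<in> Q \<rightarrow>\<^sub>M Pi\<^sub>M (insert k L) (\<lambda>_. Q)"
      using measurable_component_update[OF x KL(2)] .
    from measurable_compose[OF this f]
    have m: "(\<lambda>y. f (x(k := y))) \<in> borel_measurable (P \<Otimes>\<^sub>M unif01)" by (simp add: Q_def)
    have "(\<integral>\<^sup>+y. f (x(k := y)) \<partial>Q) = (\<integral>\<^sup>+\<delta>. (\<integral>\<^sup>+t. f (x(k := (\<delta>, t))) \<partial>unif01) \<partial>P)"
      unfolding Q_def by (rule unif.nn_integral_fst[OF m, symmetric])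
    also have "\<dots> = (\<integral>\<^sup>+\<delta>. (\<integral>\<^sup>+t. 0 \<partial>unif01) \<partial>P)"
    proof (rule nn_integral_cong, rule nn_integral_cong_AE)
      fix \<delta>
      have "AE t in unif01. S (x(k := (\<delta>, t)))"
        by (rule AE_unif01_if_subsingleton) (rule sub)
      then show "AE t in unif01. f (x(k := (\<delta>, t))) = 0" by eventually_elim (simp add: f_def)
    qed
    finally show "(\<integral>\<^sup>+y. f (x(k := y)) \<partial>Q) = 0" by simp
  qed
  finally have "integral\<^sup>N (Pi\<^sub>M K (\<lambda>_. Q)) f = 0" by simp
  then have "AE z in Pi\<^sub>M K (\<lambda>_. Q). f z = 0"
    using f KL(1) by (subst (asm) nn_integral_0_iff_AE) auto
  then show ?thesis by eventually_elim (simp add: f_def split: if_splits)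
qed

section \<open>Almost sure properties of labelled samples\<close>

lemma measurable_fst_Q: "fst \<in> Q \<rightarrow>\<^sub>M P"
  by (simp add: Q_def)

lemma distr_fst_Q: "distr Q P fst = P"
  unfolding Q_def by (rule prob_space.distr_pair_fst[OF prob_space_unif01])

lemma distr_fst:
  fixes N :: nat
  shows "distr (Pi\<^sub>M {1..N} (\<lambda>_. Q)) (Pi\<^sub>M {1..N} (\<lambda>_. P)) (compose {1..N} fst) = Pi\<^sub>M {1..N} (\<lambda>_. P)"
proof -
  have "distr (Pi\<^sub>M {1..N} (\<lambda>_. Q)) (Pi\<^sub>M {1..N} (\<lambda>_. P)) (compose {1..N} fst) =
      Pi\<^sub>M {1..N} (\<lambda>_. distr Q P fst)"
    by (rule distr_PiM_finite_prob_space')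
       (auto simp: prob_space_Q P.prob_space_axioms measurable_fst_Q)
  then show ?thesis by (simp add: distr_fst_Q)
qed

lemma measurable_fst_comp:
  fixes N :: nat
  shows "compose {1..N} fst \<in> Pi\<^sub>M {1..N} (\<lambda>_. Q) \<rightarrow>\<^sub>M Pi\<^sub>M {1..N} (\<lambda>_. P)"
  unfolding compose_def
  by (intro measurable_restrict measurable_compose[OF _ measurable_fst_Q] measurable_component_singleton)

lemma AE_fst:
  fixes N :: nat
  assumes "AE \<omega> in Pi\<^sub>M {1..N} (\<lambda>_. P). S \<omega>"
  shows "AE z in Pi\<^sub>M {1..N} (\<lambda>_. Q). S (compose {1..N} fst z)"
  using assms distr_fst[of N] AE_distrD[OF measurable_fst_comp] by metis

lemma AE_labels_nonneg:
  fixes N :: nat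
  shows "AE z in Pi\<^sub>M {1..N} (\<lambda>_. Q). \<forall>k\<in>{1..N}. 0 \<le> snd (z k)"
proof (intro AE_finite_allI)
  fix k assume k: "k \<in> {1..N}"
  interpret pair_sigma_finite P unif01
    by (intro pair_sigma_finite.intro prob_space_imp_sigma_finite P.prob_space_axioms prob_space_unif01)
  have "AE y in Q. 0 \<le> snd y"
    unfolding Q_def
  proof (rule AE_pair_measure)
    show "{y \<in> space (P \<Otimes>\<^sub>M unif01). 0 \<le> snd y} \<in> sets (P \<Otimes>\<^sub>M unif01)" by measurable
  qed (simp add: AE_unif01_nonneg)
  then show "AE z in Pi\<^sub>M {1..N} (\<lambda>_. Q). 0 \<le> snd (z k)"
    using k prob_space_Q by (intro AE_PiM_component) auto
qed simp

lemma AE_labels_distinct: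
  fixes N :: nat
  shows "AE z in Pi\<^sub>M {1..N} (\<lambda>_. Q). inj_on (\<lambda>k. snd (z k)) {1..N}"
proof -
  have "AE z in Pi\<^sub>M {1..N} (\<lambda>_. Q). snd (z i) \<noteq> snd (z j)" if "i \<in> {1..N}" "j \<in> {1..N}" "i \<noteq> j" for i j
  proof (rule AE_coordinate)
    have [measurable]: "(\<lambda>z. snd (z i)) \<in> borel_measurable (Pi\<^sub>M {1..N} (\<lambda>_. Q))"
      "(\<lambda>z. snd (z j)) \<in> borel_measurable (Pi\<^sub>M {1..N} (\<lambda>_. Q))"
      using that by (auto intro!: snd_measurable component_measurable)
    show "Measurable.pred (Pi\<^sub>M {1..N} (\<lambda>_. Q)) (\<lambda>z. snd (z i) \<noteq> snd (z j))"
      unfolding pred_def by (intro borel_measurable_neq) fact+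
  qed (use that in auto)
  then have "AE z in Pi\<^sub>M {1..N} (\<lambda>_. Q). \<forall>i\<in>{1..N}. \<forall>j\<in>{1..N}. i \<noteq> j \<longrightarrow> snd (z i) \<noteq> snd (z j)"
    by (intro AE_finite_allI AE_impI) auto
  then show ?thesis by eventually_elim (auto simp: inj_on_def)
qed

lemma AE_feasible:
  fixes N :: nat
  assumes "N \<ge> 1"
  shows "AE z in Pi\<^sub>M {1..N} (\<lambda>_. Q). \<exists>x\<in>X. \<forall>j\<in>{1..N}. g x (fst (z j)) \<le> 0"
  using AE_fst[OF feasible[OF assms]] by eventually_elim (auto simp: compose_def)

lemma vl_less_T:
  fixes N :: nat
  assumes \<rho>: "0 \<le> \<rho>" "\<rho> \<le> 1" and "\<exists>x\<in>X. \<forall>j\<in>{1..N}. g x (fst (z j)) \<le> 0"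
    and "\<forall>k\<in>{1..N}. 0 \<le> snd (z k)" and "K \<subseteq> {1..N}"
  shows "vl \<rho> (z ` K) < T"
proof -
  interpret convex_program X "obj \<rho>" T "slack \<rho>" by (rule program[OF \<rho>])
  obtain x where x: "x \<in> X" "\<And>j. j \<in> {1..N} \<Longrightarrow> g x (fst (z j)) \<le> 0" using assms(3) by blast
  have "slack \<rho> x (z j) \<le> 0" if "j \<in> K" for j
  proof -
    have "j \<in> {1..N}" using that assms(5) by blast
    moreover have "0 \<le> \<rho> * snd (z j)" using \<rho> assms(4) \<open>j \<in> {1..N}\<close> by simp
    ultimately show ?thesis using x(2)[of j] by (simp add: slack_def)
  qed
  then have "x \<in> feas (z ` K)" using x by (auto simp: feas_def)
  then show ?thesis using val_less_T_iff by blast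
qed

text \<open>The label of \<open>k\<close> enters the value for \<open>H\<close> but not the value
  for \<open>K\<close>. While \<open>k\<close> is essential, the former strictly decreases in this
  label, so equality can happen for one label only. The condition \<open>< T\<close> excludes
  infeasible programs, whose value may stay at \<open>T\<close> when the label moves.\<close>

lemma AE_nondegenerate:
  fixes N :: nat
  assumes \<rho>: "0 < \<rho>" "\<rho> \<le> 1" and HK: "H \<subseteq> {1..N}" "K \<subseteq> {1..N}" "k \<in> H - K"
  shows "AE z in Pi\<^sub>M {1..N} (\<lambda>_. Q). vl \<rho> (z ` H) < T \<and> vl \<rho> (z ` (H - {k})) < vl \<rho> (z ` H)
      \<longrightarrow> vl \<rho> (z ` H) \<noteq> vl \<rho> (z ` K)"
proof (rule AE_coordinate[where k = k])
  interpret convex_program X "obj \<rho>" T "slack \<rho>" using \<rho> by (intro program) auto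
  have "finite S" if "S \<subseteq> {1..N}" for S :: "nat set" using that finite_subset by auto
  then have vl_meas: "(\<lambda>z. val (z ` S)) \<in> borel_measurable (Pi\<^sub>M {1..N} (\<lambda>_. Q))" if "S \<subseteq> {1..N}" for S
    using that \<rho> by (intro borel_measurable_vl component_measurable) auto
  have [measurable]: "(\<lambda>z. val (z ` H)) \<in> borel_measurable (Pi\<^sub>M {1..N} (\<lambda>_. Q))"
    "(\<lambda>z. val (z ` K)) \<in> borel_measurable (Pi\<^sub>M {1..N} (\<lambda>_. Q))"
    "(\<lambda>z. val (z ` (H - {k}))) \<in> borel_measurable (Pi\<^sub>M {1..N} (\<lambda>_. Q))"
    using HK by (intro vl_meas; blast)+
  have [measurable]: "Measurable.pred (Pi\<^sub>M {1..N} (\<lambda>_. Q)) (\<lambda>z. val (z ` H) = val (z ` K))"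
    unfolding pred_def by (intro borel_measurable_eq) fact+
  show "Measurable.pred (Pi\<^sub>M {1..N} (\<lambda>_. Q)) (\<lambda>z. val (z ` H) < T \<and> val (z ` (H - {k})) < val (z ` H)
      \<longrightarrow> val (z ` H) \<noteq> val (z ` K))" by measurable
  fix x :: "nat \<Rightarrow> 'e \<times> real" and \<delta> and s t :: real
  assume st: "s < t"
  define S where "S = x ` (H - {k})"
  have upd: "(x(k := y)) ` H = insert y S" "(x(k := y)) ` (H - {k}) = S" "(x(k := y)) ` K = x ` K" for y
    using HK by (auto simp: S_def)
  assume "\<not> (val ((x(k := (\<delta>, s))) ` H) < T \<and>
      val ((x(k := (\<delta>, s))) ` (H - {k})) < val ((x(k := (\<delta>, s))) ` H) \<longrightarrow>
      val ((x(k := (\<delta>, s))) ` H) \<noteq> val ((x(k := (\<delta>, s))) ` K))"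
    and "\<not> (val ((x(k := (\<delta>, t))) ` H) < T \<and>
      val ((x(k := (\<delta>, t))) ` (H - {k})) < val ((x(k := (\<delta>, t))) ` H) \<longrightarrow>
      val ((x(k := (\<delta>, t))) ` H) \<noteq> val ((x(k := (\<delta>, t))) ` K))"
  then have eq: "val (insert (\<delta>, s) S) = val (insert (\<delta>, t) S)"
    and less: "val (insert (\<delta>, s) S) < T" "val S < val (insert (\<delta>, t) S)"
    unfolding upd by auto
  have "val (insert (\<delta>, t) S) < val (insert (\<delta>, s) S)"
    using st \<rho> less
    by (intro val_strict_of_relaxation[where e = "\<rho> * (t - s)"]) (auto simp: slack_def algebra_simps)
  then show False using eq by simp
qed (use HK in auto)

lemma miss_eq_escapes:
  assumes "j \<notin> I"
  shows "miss \<rho> I z (z j) = escapes (\<lambda>K. vl \<rho> (z ` K)) (\<lambda>k. snd (z k)) I j"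
  by (simp add: miss_def escapes_def)

lemma unique_pinned_sample:
  assumes \<rho>: "0 < \<rho>" "\<rho> \<le> 1" and N: "d \<le> N"
  shows "AE z in Pi\<^sub>M {1..N} (\<lambda>_. Q).
      \<exists>!I. I \<subseteq> {1..N} \<and> card I = d \<and> (\<forall>j\<in>{1..N} - I. \<not> miss \<rho> I z (z j))"
proof -
  interpret strictly_convex_program X "obj \<rho>" T "slack \<rho>" by (rule strict_program[OF \<rho>])
  have N1: "N \<ge> 1" using N d_pos by simp
  have "AE z in Pi\<^sub>M {1..N} (\<lambda>_. Q). \<forall>H\<in>Pow {1..N}. \<forall>K\<in>Pow {1..N}. \<forall>k\<in>H - K.
      vl \<rho> (z ` H) < T \<and> vl \<rho> (z ` (H - {k})) < vl \<rho> (z ` H) \<longrightarrow> vl \<rho> (z ` H) \<noteq> vl \<rho> (z ` K)"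
    using \<rho> by (intro AE_finite_allI AE_nondegenerate) (auto intro: finite_subset)
  with AE_labels_nonneg[of N] AE_labels_distinct[of N] AE_feasible[OF N1] AE_fst[OF rank[of N]]
  show ?thesis
  proof eventually_elim
    case (elim z)
    have less_T: "val (z ` K) < T" if "K \<subseteq> {1..N}" for K
      using \<rho> elim that by (intro vl_less_T) auto
    have "\<exists>!I. I \<subseteq> {1..N} \<and> card I = d \<and>
        (\<forall>j\<in>{1..N} - I. \<not> escapes (\<lambda>K. val (z ` K)) (\<lambda>k. snd (z k)) I j)"
    proof (rule unique_pinned_basis)
      show "val (z ` H) \<le> val (z ` K)" if "H \<subseteq> K" for H K
        using that by (intro val_mono image_mono)
      show "val (z ` {1..N}) = val (z ` H)"
        if H: "H \<subseteq> {1..N}" and eq: "\<And>j. j \<in> {1..N} \<Longrightarrow> val (z ` insert j H) = val (z ` H)" for H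
      proof -
        have "val (z ` H \<union> z ` {1..N}) = val (z ` H)"
          using eq by (intro val_Un_eq) auto
        moreover have "z ` H \<union> z ` {1..N} = z ` {1..N}" using H by blast
        ultimately show ?thesis by simp
      qed
      have "rank_bounded d X (\<lambda>x k. g x (compose {1..N} fst z k)) {1..N} =
          rank_bounded d X (\<lambda>x k. g x (fst (z k))) {1..N}"
        unfolding rank_bounded_def
        by (intro all_cong imp_cong ex_cong conj_cong ball_cong bex_cong arg_cong2[of _ _ _ _ "(=)"] sum.cong refl)
           (auto simp: compose_def subset_iff)
      then have rk: "rank_bounded d X (\<lambda>x k. g x (fst (z k))) {1..N}" using elim by simp
      show "\<exists>B\<subseteq>{1..N}. card B \<le> d \<and> val (z ` B) = val (z ` {1..N})"
        using elim \<rho> by (intro small_basis[OF _ rk, of z \<rho> "\<lambda>k. snd (z k)"]) (auto simp: slack_def)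
      show "val (z ` H) \<noteq> val (z ` K)"
        if "H \<subseteq> {1..N}" "K \<subseteq> {1..N}" "k \<in> H - K" "val (z ` (H - {k})) < val (z ` H)" for H K k
        using elim that less_T by blast
    qed (use elim N in auto)
    moreover have "(\<forall>j\<in>{1..N} - I. \<not> miss \<rho> I z (z j)) \<longleftrightarrow>
        (\<forall>j\<in>{1..N} - I. \<not> escapes (\<lambda>K. val (z ` K)) (\<lambda>k. snd (z k)) I j)" for I
      using miss_eq_escapes[of _ I \<rho> z] by auto
    ultimately show ?case by simp
  qed
qed

lemma compression:
  assumes \<rho>: "0 < \<rho>" "\<rho> \<le> 1"
  shows "unique_compression Q d (miss \<rho>)"
proof (intro unique_compression.intro unique_compression_axioms.intro prob_space_Q d_pos)
  fix I :: "nat set" assume I: "finite I" "card I = d"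
  let ?M = "Pi\<^sub>M I (\<lambda>_. Q) \<Otimes>\<^sub>M Q"
  note \<rho>' = less_imp_le[OF \<rho>(1)] \<rho>(2)
  have vl_meas: "(\<lambda>p. vl \<rho> (fst p ` K)) \<in> borel_measurable ?M" if "K \<subseteq> I" for K
    using that I \<rho>' by (intro borel_measurable_vl fst_component_measurable) (auto intro: finite_subset)
  have [measurable]: "(\<lambda>p. vl \<rho> (insert (snd p) (fst p ` I))) \<in> borel_measurable ?M"
    using I \<rho>' by (intro borel_measurable_vl_insert fst_component_measurable measurable_snd) auto
  have [measurable]: "(\<lambda>p. vl \<rho> (fst p ` I)) \<in> borel_measurable ?M" by (rule vl_meas) simp
  have "Measurable.pred ?M (\<lambda>p. \<exists>b\<in>I. vl \<rho> (fst p ` (I - {b})) = vl \<rho> (fst p ` I) \<and> snd (snd p) < snd (fst p b))"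
  proof (intro pred_intros_finite I)
    fix b assume b: "b \<in> I"
    have [measurable]: "(\<lambda>p. vl \<rho> (fst p ` (I - {b}))) \<in> borel_measurable ?M" by (rule vl_meas) auto
    have [measurable]: "(\<lambda>p. snd (fst p b)) \<in> borel_measurable ?M" "(\<lambda>p. snd (snd p)) \<in> borel_measurable ?M"
      by (intro snd_measurable fst_component_measurable b measurable_snd)+
    show "Measurable.pred ?M (\<lambda>p. vl \<rho> (fst p ` (I - {b})) = vl \<rho> (fst p ` I) \<and> snd (snd p) < snd (fst p b))"
      by measurable
  qed
  then have "Measurable.pred ?M (\<lambda>p. miss \<rho> I (fst p) (snd p))"
    unfolding miss_def by measurable
  then show "{p \<in> space ?M. miss \<rho> I (fst p) (snd p)} \<in> sets ?M" by (simp add: pred_def)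
next
  fix I :: "nat set" and x y :: "nat \<Rightarrow> 'e \<times> real" and h assume eq: "\<And>i. i \<in> I \<Longrightarrow> x i = y i"
  have "x ` K = y ` K" if "K \<subseteq> I" for K using eq that by (intro image_cong) auto
  then show "miss \<rho> I x h = miss \<rho> I y h"
    unfolding miss_def using eq by (simp cong: bex_cong)
next
  fix \<pi> and I J :: "nat set" and x :: "nat \<Rightarrow> 'e \<times> real" and h assume \<pi>: "bij_betw \<pi> I J"
  have J: "J = \<pi> ` I" using \<pi> by (simp add: bij_betw_def)
  have "(\<lambda>i. x (\<pi> i)) ` (I - {b}) = x ` (J - {\<pi> b})" if "b \<in> I" for b
  proof -
    have "\<pi> ` (I - {b}) = J - {\<pi> b}"
      using \<pi> that inj_on_image_set_diff[of \<pi> I I "{b}"] by (auto simp: J bij_betw_def)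
    then show ?thesis by (metis image_image)
  qed
  moreover have "(\<lambda>i. x (\<pi> i)) ` I = x ` J" by (auto simp: J)
  ultimately show "miss \<rho> I (\<lambda>i. x (\<pi> i)) h = miss \<rho> J x h"
    unfolding miss_def by (simp add: J cong: bex_cong)
next
  fix N assume "d \<le> N"
  then show "AE z in Pi\<^sub>M {1..N} (\<lambda>_. Q).
      \<exists>!I. I \<subseteq> {1..N} \<and> card I = d \<and> (\<forall>j\<in>{1..N} - I. \<not> miss \<rho> I z (z j))"
    using unique_pinned_sample[OF \<rho>] by simp
qed

text \<open>Neither \<open>h\<close> nor any sample changes the value for \<open>I\<close> on its
  own, so by locality all of them together do not. A violation by \<open>h\<close> therefore forces
  a miss, and the risk is at most \<open>1 - agree\<close>.\<close>

lemma not_viol_if_pinned: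
  assumes \<rho>: "0 < \<rho>" "\<rho> \<le> 1" and I: "I \<subseteq> {1..N}"
    and pinned: "\<forall>j\<in>{1..N} - I. \<not> miss \<rho> I z (z j)" and h: "\<not> miss \<rho> I z h"
  shows "\<not> viol \<rho> N z h"
proof -
  interpret strictly_convex_program X "obj \<rho>" T "slack \<rho>" by (rule strict_program[OF \<rho>])
  have eq: "val (insert y (z ` I)) = val (z ` I)" if "\<not> miss \<rho> I z y \<or> y \<in> z ` I" for y
    using that val_mono[OF subset_insertI[of "z ` I" y]]
    by (auto simp: miss_def insert_absorb dest: antisym)
  have "val (z ` I \<union> insert h (z ` {1..N})) = val (z ` I)"
    using pinned h by (intro val_Un_eq eq) auto
  moreover have "z ` I \<union> insert h (z ` {1..N}) = insert h (z ` {1..N})" using I by blast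
  ultimately show ?thesis
    unfolding viol_def using val_mono[OF image_mono[OF I], of z] by simp
qed

lemma pred_viol:
  assumes \<rho>: "0 \<le> \<rho>" "\<rho> \<le> 1"
  shows "Measurable.pred (Pi\<^sub>M {1..N} (\<lambda>_. Q) \<Otimes>\<^sub>M Q) (\<lambda>p. viol \<rho> N (fst p) (snd p))"
proof -
  let ?M = "Pi\<^sub>M {1..N} (\<lambda>_. Q) \<Otimes>\<^sub>M Q"
  have [measurable]: "(\<lambda>p. vl \<rho> (insert (snd p) (fst p ` {1..N}))) \<in> borel_measurable ?M"
    "(\<lambda>p. vl \<rho> (fst p ` {1..N})) \<in> borel_measurable ?M"
    using \<rho> by (intro borel_measurable_vl_insert borel_measurable_vl fst_component_measurable measurable_snd; simp)+
  show ?thesis unfolding viol_def by measurable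
qed

section \<open>The risk and its limit under vanishing perturbation\<close>

definition risk :: "real \<Rightarrow> nat \<Rightarrow> (nat \<Rightarrow> 'e \<times> real) \<Rightarrow> ennreal" where
  "risk \<rho> N z = emeasure Q {h\<in>space Q. viol \<rho> N z h}"

lemma measurable_risk:
  assumes \<rho>: "0 \<le> \<rho>" "\<rho> \<le> 1"
  shows "risk \<rho> N \<in> borel_measurable (Pi\<^sub>M {1..N} (\<lambda>_. Q))"
proof -
  interpret Q: prob_space Q by (rule prob_space_Q)
  let ?M = "Pi\<^sub>M {1..N} (\<lambda>_. Q)"
  define S where "S = {p \<in> space (?M \<Otimes>\<^sub>M Q). viol \<rho> N (fst p) (snd p)}"
  have "S \<in> sets (?M \<Otimes>\<^sub>M Q)" unfolding S_def using pred_viol[OF \<rho>] by (simp add: pred_def)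
  from Q.finite_measure_cut_measurable[OF this]
  have "(\<lambda>z. emeasure Q (Pair z -` S)) \<in> borel_measurable ?M" .
  moreover have "emeasure Q (Pair z -` S) = risk \<rho> N z" if "z \<in> space ?M" for z
    using that unfolding risk_def S_def
    by (intro arg_cong[of _ _ "emeasure Q"]) (auto simp: space_pair_measure)
  ultimately show ?thesis by (simp cong: measurable_cong)
qed

lemma sets_viol:
  assumes "0 \<le> \<rho>" "\<rho> \<le> 1" "z \<in> space (Pi\<^sub>M {1..N} (\<lambda>_. Q))"
  shows "{h\<in>space Q. viol \<rho> N z h} \<in> sets Q"
proof -
  have "(\<lambda>h. (z, h)) \<in> Q \<rightarrow>\<^sub>M Pi\<^sub>M {1..N} (\<lambda>_. Q) \<Otimes>\<^sub>M Q" using assms by measurable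
  from measurable_compose[OF this pred_viol[OF assms(1,2)]] show ?thesis by (simp add: pred_def)
qed

lemma perturbed_risk_bound:
  assumes \<rho>: "0 < \<rho>" "\<rho> \<le> 1" and N: "d \<le> N" and \<epsilon>: "0 < \<epsilon>" "\<epsilon> \<le> 1"
  shows "emeasure (Pi\<^sub>M {1..N} (\<lambda>_. Q)) {z\<in>space (Pi\<^sub>M {1..N} (\<lambda>_. Q)). ennreal \<epsilon> < risk \<rho> N z}
    \<le> ennreal (\<Sum>j<d. real (N choose j) * \<epsilon> ^ j * (1 - \<epsilon>) ^ (N - j))"
proof -
  interpret unique_compression Q d "miss \<rho>" by (rule compression[OF \<rho>])
  let ?M = "Pi\<^sub>M {1..N} (\<lambda>_. Q)"
  let ?S = "{z\<in>space ?M. \<exists>I\<in>candidates N. pinned N I z \<and> agree I z < 1 - \<epsilon>}"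
  have "?S \<in> sets ?M" by (rule sets_exceptional)
  have "emeasure ?M {z\<in>space ?M. ennreal \<epsilon> < risk \<rho> N z} \<le> emeasure ?M ?S"
  proof (rule emeasure_mono_AE[OF _ \<open>?S \<in> sets ?M\<close>])
    show "AE z in ?M. z \<in> {z\<in>space ?M. ennreal \<epsilon> < risk \<rho> N z} \<longrightarrow> z \<in> ?S"
      using unique_pinned[OF N] AE_space
    proof eventually_elim
      case (elim z)
      from elim(1) obtain I where I: "I \<in> candidates N" "pinned N I z"
        unfolding pinned_def by blast
      have "agree I z < 1 - \<epsilon>" if z: "ennreal \<epsilon> < risk \<rho> N z"
      proof -
        have sets: "{h\<in>space Q. viol \<rho> N z h} \<in> events"
          using \<rho> elim(2) by (intro sets_viol) auto
        have "risk \<rho> N z = ennreal (prob {h\<in>space Q. viol \<rho> N z h})"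
          by (simp add: risk_def emeasure_eq_measure)
        then have "\<epsilon> < prob {h\<in>space Q. viol \<rho> N z h}"
          using z \<epsilon> by (simp add: ennreal_less_iff)
        moreover have "agree I z \<le> prob (space Q - {h\<in>space Q. viol \<rho> N z h})"
          unfolding agree_def
        proof (rule finite_measure_mono)
          show "{h\<in>space Q. \<not> miss \<rho> I z h} \<subseteq> space Q - {h\<in>space Q. viol \<rho> N z h}"
            using not_viol_if_pinned[OF \<rho>, of I N z] I by (auto simp: pinned_def)
        qed (use sets in auto)
        ultimately show ?thesis using prob_compl[OF sets] by simp
      qed
      then show ?case using I by blast
    qed
  qed
  also have "\<dots> \<le> ennreal (\<Sum>j<d. real (N choose j) * (1 - (1 - \<epsilon>)) ^ j * (1 - \<epsilon>) ^ (N - j))"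
    using \<epsilon> by (intro compression_bound[OF N]) auto
  finally show ?thesis by simp
qed

text \<open>Semicontinuity in \<rho>: otherwise \<open>h\<close> costs nothing for infinitely many
  perturbations, and the points \<open>y n\<close> witnessing this accumulate in the compact
  \<open>X\<close> at a point that is feasible with \<open>h\<close> and whose cost is at most the
  optimum without \<open>h\<close>. Nonnegative labels keep the unperturbed minimiser
  \<open>x0\<close> feasible for the perturbed programs, which bounds the costs along the
  sequence.\<close>

lemma eventually_viol:
  assumes feas: "\<exists>x\<in>X. \<forall>j\<in>{1..N}. g x (fst (z j)) \<le> 0" and lab: "\<forall>k\<in>{1..N}. 0 \<le> snd (z k)"
    and viol: "viol 0 N z h"
  shows "\<forall>\<^sub>F n in sequentially. viol (1 / real (Suc n)) N z h"
proof (rule ccontr)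
  define \<rho> where "\<rho> n = 1 / real (Suc n)" for n
  have \<rho>: "0 < \<rho> n" "\<rho> n \<le> 1" for n by (auto simp: \<rho>_def)
  have \<rho>_lim: "\<rho> \<longlonglongrightarrow> 0" unfolding \<rho>_def using LIMSEQ_Suc[OF lim_1_over_n] by simp
  define Z where "Z = z ` {1..N}"
  interpret p0: convex_program X "obj 0" T "slack 0" by (rule program) auto
  interpret pn: convex_program X "obj (\<rho> n)" T "slack (\<rho> n)" for n
    using \<rho>[of n] by (intro program) auto
  have "p0.val Z < T" unfolding Z_def using feas lab by (intro vl_less_T) auto
  then obtain x0 where x0: "x0 \<in> p0.feas Z" "obj 0 x0 = p0.val Z"
    using p0.val_less_T_iff p0.val_attained by metis
  have Z_less_T: "pn.val n Z < T" for n
    unfolding Z_def using feas lab \<rho>[of n] by (intro vl_less_T) auto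
  have x0_feas: "x0 \<in> pn.feas n Z" for n
  proof -
    have "slack (\<rho> n) x0 y \<le> 0" if "y \<in> Z" for y
    proof -
      have "0 \<le> \<rho> n * snd y" using that lab \<rho>[of n] by (auto simp: Z_def)
      moreover have "g x0 (fst y) \<le> 0" using x0(1) that by (simp add: p0.feas_def slack_def)
      ultimately show ?thesis by (simp add: slack_def)
    qed
    then show ?thesis using x0(1) by (simp add: pn.feas_def p0.feas_def)
  qed
  assume "\<not> (\<forall>\<^sub>F n in sequentially. viol (1 / real (Suc n)) N z h)"
  then have "\<forall>m. \<exists>n\<ge>m. \<not> viol (\<rho> n) N z h"
    unfolding eventually_sequentially \<rho>_def by blast
  then have "infinite {n. pn.val n (insert h Z) \<le> pn.val n Z}"
    unfolding infinite_nat_iff_unbounded_le viol_def Z_def not_less mem_Collect_eq .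
  from infinite_enumerate[OF this] obtain s :: "nat \<Rightarrow> nat" where s: "strict_mono s"
    "\<And>n. pn.val (s n) (insert h Z) \<le> pn.val (s n) Z" by auto
  have "\<exists>y. y \<in> pn.feas (s n) (insert h Z) \<and> obj (\<rho> (s n)) y \<le> pn.val (s n) Z" for n
    using s(2)[of n] pn.val_le_iff[OF Z_less_T, of "s n" "insert h Z" "s n"] by blast
  then obtain y where y: "\<And>n. y n \<in> pn.feas (s n) (insert h Z)"
    "\<And>n. obj (\<rho> (s n)) (y n) \<le> pn.val (s n) Z" by metis
  have yX: "y n \<in> X" for n using y(1)[of n] by (simp add: pn.feas_def)
  obtain w r where w: "w \<in> X" "strict_mono r" "(y \<circ> r) \<longlonglongrightarrow> w"
    using compact_X yX unfolding compact_def by blast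
  have \<rho>sr: "(\<lambda>n. \<rho> (s (r n))) \<longlonglongrightarrow> 0"
    using LIMSEQ_subseq_LIMSEQ[OF \<rho>_lim strict_mono_o[OF s(1) w(2)]] by (simp add: o_def)
  have "g w (fst v) \<le> 0" if v: "v \<in> insert h Z" for v
  proof (rule LIMSEQ_le)
    have "isCont (\<lambda>x. g x (fst v)) w"
      using convex_on_continuous[OF open_UNIV convex_g] by (simp add: continuous_on_eq_continuous_at)
    then show "(\<lambda>n. g (y (r n)) (fst v)) \<longlonglongrightarrow> g w (fst v)"
      using isCont_tendsto_compose w(3) by (fastforce simp: o_def)
    show "(\<lambda>n. \<rho> (s (r n)) * snd v) \<longlonglongrightarrow> 0"
      using tendsto_mult_right[OF \<rho>sr, of "snd v"] by simp
    have "g (y n) (fst v) \<le> \<rho> (s n) * snd v" for n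
      using y(1)[of n] v by (auto simp: pn.feas_def slack_def)
    then show "\<exists>m. \<forall>n\<ge>m. g (y (r n)) (fst v) \<le> \<rho> (s (r n)) * snd v" by blast
  qed
  then have "w \<in> p0.feas (insert h Z)" using w(1) by (auto simp: p0.feas_def slack_def)
  then have "p0.val (insert h Z) \<le> obj 0 w" by (rule p0.val_le)
  also have "obj 0 w \<le> obj 0 x0"
  proof (rule LIMSEQ_le)
    show "(\<lambda>n. cost \<bullet> y (r n)) \<longlonglongrightarrow> obj 0 w"
      using w(3) by (auto simp: obj_def o_def intro!: tendsto_intros)
    show "(\<lambda>n. obj 0 x0 + \<rho> (s (r n)) * (x0 \<bullet> x0)) \<longlonglongrightarrow> obj 0 x0"
      using tendsto_add[OF tendsto_const tendsto_mult_right[OF \<rho>sr, of "x0 \<bullet> x0"], of "obj 0 x0"] by simp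
    have "cost \<bullet> y n \<le> obj 0 x0 + \<rho> (s n) * (x0 \<bullet> x0)" for n
    proof -
      have "cost \<bullet> y n \<le> obj (\<rho> (s n)) (y n)" using \<rho>[of "s n"] by (simp add: obj_def)
      also have "\<dots> \<le> pn.val (s n) Z" by (rule y(2))
      also have "\<dots> \<le> obj (\<rho> (s n)) x0" by (rule pn.val_le[OF x0_feas])
      finally show ?thesis by (simp add: obj_def)
    qed
    then show "\<exists>m. \<forall>n\<ge>m. cost \<bullet> y (r n) \<le> obj 0 x0 + \<rho> (s (r n)) * (x0 \<bullet> x0)" by blast
  qed
  finally show False using viol x0(2) by (simp add: viol_def Z_def)
qed

text \<open>Two limits are nested: Fatou over the new sample bounds the unperturbed risk by the
  limit inferior of the perturbed ones, and Fatou over the multi-sample carries the probability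
  over. The strict inequality \<open>\<epsilon> < risk\<close> matters, since it places
  \<open>z\<close> in all but finitely many of the sets \<open>S n\<close>.\<close>

lemma risk_bound:
  assumes N: "d \<le> N" and \<epsilon>: "0 < \<epsilon>" "\<epsilon> \<le> 1"
  shows "emeasure (Pi\<^sub>M {1..N} (\<lambda>_. Q)) {z\<in>space (Pi\<^sub>M {1..N} (\<lambda>_. Q)). ennreal \<epsilon> < risk 0 N z}
    \<le> ennreal (\<Sum>j<d. real (N choose j) * \<epsilon> ^ j * (1 - \<epsilon>) ^ (N - j))" (is "_ \<le> ?b")
proof -
  let ?M = "Pi\<^sub>M {1..N} (\<lambda>_. Q)"
  define \<rho> where "\<rho> n = 1 / real (Suc n)" for n
  have \<rho>: "0 < \<rho> n" "0 \<le> \<rho> n" "\<rho> n \<le> 1" for n by (auto simp: \<rho>_def)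
  have N1: "N \<ge> 1" using N d_pos by simp
  define S where "S n = {z\<in>space ?M. ennreal \<epsilon> < risk (\<rho> n) N z}" for n
  have sets: "{z\<in>space ?M. ennreal \<epsilon> < risk r N z} \<in> sets ?M" if "0 \<le> r" "r \<le> 1" for r
  proof -
    note [measurable] = measurable_risk[OF that]
    show ?thesis by measurable
  qed
  have "emeasure ?M {z\<in>space ?M. ennreal \<epsilon> < risk 0 N z} \<le> liminf (\<lambda>n. emeasure ?M (S n))"
  proof (rule emeasure_le_liminf)
    show "AE z in ?M. z \<in> {z\<in>space ?M. ennreal \<epsilon> < risk 0 N z} \<longrightarrow> (\<forall>\<^sub>F n in sequentially. z \<in> S n)"
      using AE_feasible[OF N1] AE_labels_nonneg AE_space
    proof eventually_elim
      case (elim z)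
      have "risk 0 N z \<le> liminf (\<lambda>n. risk (\<rho> n) N z)"
        unfolding risk_def
      proof (rule emeasure_le_liminf)
        show "AE h in Q. h \<in> {h\<in>space Q. viol 0 N z h} \<longrightarrow>
            (\<forall>\<^sub>F n in sequentially. h \<in> {h\<in>space Q. viol (\<rho> n) N z h})"
          using eventually_viol[OF elim(1,2)] by (intro AE_I2) (simp add: \<rho>_def)
      qed (use elim(3) \<rho> in \<open>auto intro!: sets_viol\<close>)
      then show ?case
        unfolding S_def using elim(3) less_LiminfD[of "ennreal \<epsilon>" sequentially]
        by (auto dest: less_le_trans)
    qed
  qed (use sets \<rho> in \<open>auto simp: S_def\<close>)
  also have "\<dots> \<le> liminf (\<lambda>n. ?b)"
    unfolding S_def using perturbed_risk_bound[OF \<rho>(1,3) N \<epsilon>] by (intro Liminf_mono) auto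
  finally show ?thesis by (simp add: Liminf_const)
qed

section \<open>Return to unlabelled samples\<close>

definition lift :: "nat \<Rightarrow> (nat \<Rightarrow> 'e) \<Rightarrow> nat \<Rightarrow> 'e \<times> real" where
  "lift N \<omega> = (\<lambda>i\<in>{1..N}. (\<omega> i, 0))"

lemma measurable_lift: "lift N \<in> Pi\<^sub>M {1..N} (\<lambda>_. P) \<rightarrow>\<^sub>M Pi\<^sub>M {1..N} (\<lambda>_. Q)"
  unfolding lift_def Q_def
  by (intro measurable_restrict measurable_Pair measurable_component_singleton measurable_const) auto

text \<open>For \<rho> = 0 the labels drop out of \<open>slack\<close>, so the label 0 chosen by
  \<open>lift\<close> is immaterial.\<close>

lemma risk_lift: "risk 0 N (lift N (compose {1..N} fst z)) = risk 0 N z"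
proof -
  interpret convex_program X "obj 0" T "slack 0" by (rule program) auto
  have "feas (lift N (compose {1..N} fst z) ` {1..N} \<union> S) = feas (z ` {1..N} \<union> S)" for S
    by (simp add: feas_def ball_Un lift_def compose_def slack_def)
  from this[of "{}"] this[of "{h}" for h] show ?thesis
    by (simp add: risk_def viol_def val_def)
qed

text \<open>If \<open>h\<close> did not raise the value, some feasible point satisfying
  \<open>h\<close> would cost no more than \<open>x\<close>; by uniqueness it would be
  \<open>x\<close> itself, which violates \<open>h\<close>.\<close>

lemma viol_if_minimizer_violated:
  assumes x: "x \<in> X" "\<forall>j\<in>{1..N}. g x (\<omega> j) \<le> 0"
    and uniq: "\<And>y. y \<in> X \<Longrightarrow> \<forall>j\<in>{1..N}. g y (\<omega> j) \<le> 0 \<Longrightarrow> y \<noteq> x \<Longrightarrow> cost \<bullet> x < cost \<bullet> y"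
    and h: "g x (fst h) > 0"
  shows "viol 0 N (lift N \<omega>) h"
proof (rule ccontr)
  interpret convex_program X "obj 0" T "slack 0" by (rule program) auto
  define S where "S = lift N \<omega> ` {1..N}"
  have feas_iff: "y \<in> feas S \<longleftrightarrow> y \<in> X \<and> (\<forall>j\<in>{1..N}. g y (\<omega> j) \<le> 0)" for y
    by (auto simp: feas_def S_def lift_def slack_def)
  have xS: "x \<in> feas S" using x feas_iff by blast
  then have less: "val S < T" using val_less_T_iff by blast
  assume "\<not> viol 0 N (lift N \<omega>) h"
  then have "val (insert h S) \<le> val S" by (simp add: viol_def S_def)
  then obtain y where y: "y \<in> feas (insert h S)" "obj 0 y \<le> val S"
    using val_le_iff[OF less] by blast
  have "y \<in> feas S" using y(1) feas_mono[of S "insert h S"] by blast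
  moreover have "cost \<bullet> y \<le> cost \<bullet> x" using y(2) val_le[OF xS] by (simp add: obj_def)
  ultimately have "y = x" using uniq[of y] feas_iff by force
  then show False using y(1) h by (simp add: feas_def slack_def)
qed

text \<open>The event \<open>E\<close> is cut out by the risk, which is measurable, and not by the
  solution map, which may fail to be. Optimality and uniqueness of \<open>x\<close> are imposed
  pointwise on \<open>E\<close>.\<close>

theorem confidence:
  assumes N: "d \<le> N" and \<epsilon>: "0 < \<epsilon>" "\<epsilon> \<le> 1"
  shows "\<exists>E\<in>sets (Pi\<^sub>M {1..N} (\<lambda>_. P)).
    1 - (\<Sum>j<d. real (N choose j) * \<epsilon> ^ j * (1 - \<epsilon>) ^ (N - j)) \<le> measure (Pi\<^sub>M {1..N} (\<lambda>_. P)) E \<and>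
    (\<forall>\<omega>\<in>E. \<forall>x\<in>X. (\<forall>j\<in>{1..N}. g x (\<omega> j) \<le> 0) \<longrightarrow>
      (\<forall>y\<in>X. (\<forall>j\<in>{1..N}. g y (\<omega> j) \<le> 0) \<longrightarrow> y \<noteq> x \<longrightarrow> cost \<bullet> x < cost \<bullet> y) \<longrightarrow>
      1 - \<epsilon> \<le> P.prob {\<delta>\<in>space P. g x \<delta> \<le> 0})"
proof -
  let ?M = "Pi\<^sub>M {1..N} (\<lambda>_. P)"
  let ?b = "\<Sum>j<d. real (N choose j) * \<epsilon> ^ j * (1 - \<epsilon>) ^ (N - j)"
  interpret M: prob_space ?M by (intro prob_space_PiM P.prob_space_axioms)
  define S where "S = {\<omega>\<in>space ?M. ennreal \<epsilon> < risk 0 N (lift N \<omega>)}"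
  have [measurable]: "(\<lambda>\<omega>. risk 0 N (lift N \<omega>)) \<in> borel_measurable ?M"
    by (rule measurable_compose[OF measurable_lift measurable_risk]) auto
  have S: "S \<in> sets ?M" unfolding S_def by measurable
  have "emeasure ?M S = emeasure (distr (Pi\<^sub>M {1..N} (\<lambda>_. Q)) ?M (compose {1..N} fst)) S"
    by (simp add: distr_fst)
  also have "\<dots> = emeasure (Pi\<^sub>M {1..N} (\<lambda>_. Q)) (compose {1..N} fst -` S \<inter> space (Pi\<^sub>M {1..N} (\<lambda>_. Q)))"
    by (rule emeasure_distr[OF measurable_fst_comp S])
  also have "compose {1..N} fst -` S \<inter> space (Pi\<^sub>M {1..N} (\<lambda>_. Q)) =
      {z\<in>space (Pi\<^sub>M {1..N} (\<lambda>_. Q)). ennreal \<epsilon> < risk 0 N z}"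
    using measurable_space[OF measurable_fst_comp] by (auto simp: S_def risk_lift)
  also have "emeasure (Pi\<^sub>M {1..N} (\<lambda>_. Q)) \<dots> \<le> ennreal ?b" by (rule risk_bound[OF N \<epsilon>])
  finally have "ennreal (measure ?M S) \<le> ennreal ?b" by (simp add: M.emeasure_eq_measure)
  moreover have "0 \<le> ?b" using \<epsilon> by (intro sum_nonneg) auto
  ultimately have "measure ?M S \<le> ?b" by simp
  then have meas: "1 - ?b \<le> measure ?M (space ?M - S)" using M.prob_compl[OF S] by simp
  have "1 - \<epsilon> \<le> P.prob {\<delta>\<in>space P. g x \<delta> \<le> 0}"
    if \<omega>: "\<omega> \<in> space ?M - S" and x: "x \<in> X" "\<forall>j\<in>{1..N}. g x (\<omega> j) \<le> 0"
    and uniq: "\<And>y. y \<in> X \<Longrightarrow> \<forall>j\<in>{1..N}. g y (\<omega> j) \<le> 0 \<Longrightarrow> y \<noteq> x \<Longrightarrow> cost \<bullet> x < cost \<bullet> y"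
    for \<omega> x
  proof -
    note [measurable] = measurable_g[OF x(1)]
    have B: "{\<delta>\<in>space P. g x \<delta> > 0} \<in> sets P" by measurable
    have "emeasure P {\<delta>\<in>space P. g x \<delta> > 0} = emeasure (distr Q P fst) {\<delta>\<in>space P. g x \<delta> > 0}"
      by (simp add: distr_fst_Q)
    also have "\<dots> = emeasure Q (fst -` {\<delta>\<in>space P. g x \<delta> > 0} \<inter> space Q)"
      by (rule emeasure_distr[OF measurable_fst_Q B])
    also have "\<dots> \<le> risk 0 N (lift N \<omega>)"
      unfolding risk_def
    proof (rule emeasure_mono)
      show "fst -` {\<delta>\<in>space P. g x \<delta> > 0} \<inter> space Q \<subseteq> {h\<in>space Q. viol 0 N (lift N \<omega>) h}"
        using viol_if_minimizer_violated[OF x uniq] by blast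
      show "{h\<in>space Q. viol 0 N (lift N \<omega>) h} \<in> sets Q"
        using \<omega> by (intro sets_viol measurable_space[OF measurable_lift]) auto
    qed
    also have "\<dots> \<le> ennreal \<epsilon>" using \<omega> by (simp add: S_def not_less)
    finally have "P.prob {\<delta>\<in>space P. g x \<delta> > 0} \<le> \<epsilon>" using \<epsilon> by (simp add: P.emeasure_eq_measure)
    moreover have "{\<delta>\<in>space P. g x \<delta> \<le> 0} = space P - {\<delta>\<in>space P. g x \<delta> > 0}" by auto
    ultimately show ?thesis using P.prob_compl[OF B] by simp
  qed
  then show ?thesis
    using meas S by (intro bexI[of _ "space ?M - S"] conjI ballI impI) auto
qed

end

section \<open>The given program as an instance of the labelled setting\<close>

theorem theorem2:
  fixes \<Delta> :: "(real^'d) set"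
    and P :: "(real^'d) measure"
    and X :: "(real^'n) set"
    and cost :: "real^'n"
    and r N :: nat
    and A :: "nat \<Rightarrow> real^'n \<Rightarrow> real^'d^'d"
    and b :: "nat \<Rightarrow> real^'n \<Rightarrow> real^'d"
    and c :: "nat \<Rightarrow> real^'n \<Rightarrow> real"
    and gi :: "nat \<Rightarrow> real^'n \<Rightarrow> real^'d \<Rightarrow> real"
    and g :: "real^'n \<Rightarrow> real^'d \<Rightarrow> real"
    and \<epsilon> \<beta> :: real
    and \<zeta> :: nat
  assumes "prob_space P" and "space P = \<Delta>"
    and "compact X" and "convex X"
    and "r \<ge> 1"
    and "\<And>i x \<delta>. i \<in> {1..r} \<Longrightarrow> \<delta> \<in> \<Delta> \<Longrightarrow>
           gi i x \<delta> = \<delta> \<bullet> (A i x *v \<delta>) + b i x \<bullet> \<delta> + c i x"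
    and "\<And>x \<delta>. \<delta> \<in> \<Delta> \<Longrightarrow> g x \<delta> = Max ((\<lambda>i. gi i x \<delta>) ` {1..r})"
    and "standing_regularity P cost X g"
    and "0 < \<epsilon>" and "\<epsilon> < 1" and "0 < \<beta>" and "\<beta> < 1"
    and "\<zeta> = r * CARD('d) * (CARD('d) + 3) div 2 + r"
    and "(\<Sum>j = 0..\<zeta> - 1. real (N choose j) * \<epsilon> ^ j * (1 - \<epsilon>) ^ (N - j)) \<le> \<beta>"
  shows "with_confidence (multisample N P) (1 - \<beta>)
           (\<lambda>\<omega>. (\<exists>!x. sp_solution cost X g N \<omega> x) \<and>
                (\<forall>x. sp_solution cost X g N \<omega> x \<longrightarrow> ccp_feasible P X g \<epsilon> x))"
proof -
  interpret P: prob_space P by fact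
  have \<zeta>: "\<zeta> \<ge> 1" using assms(5,13) by simp
  \<comment> \<open>\<open>\<zeta> \<ge> 1\<close> makes the truncated subtraction in
    \<open>\<zeta> - 1\<close> exact.\<close>
  have sum_eq: "(\<Sum>j = 0..\<zeta> - 1. real (N choose j) * \<epsilon> ^ j * (1 - \<epsilon>) ^ (N - j)) =
      (\<Sum>j<\<zeta>. real (N choose j) * \<epsilon> ^ j * (1 - \<epsilon>) ^ (N - j))"
    using \<zeta> by (intro sum.cong) auto
  \<comment> \<open>With fewer than \<zeta> samples the sum would be the whole binomial expansion,
    which is 1 and exceeds \<beta>.\<close>
  have N: "\<zeta> \<le> N"
  proof (rule ccontr)
    assume "\<not> \<zeta> \<le> N"
    then have "(\<Sum>j<\<zeta>. real (N choose j) * \<epsilon> ^ j * (1 - \<epsilon>) ^ (N - j)) =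
        (\<Sum>j\<le>N. real (N choose j) * \<epsilon> ^ j * (1 - \<epsilon>) ^ (N - j))"
      by (intro sum.mono_neutral_right) auto
    also have "\<dots> = (\<epsilon> + (1 - \<epsilon>)) ^ N" by (rule binomial_ring[symmetric])
    finally show False using assms(12,14) sum_eq by simp
  qed
  have N1: "N \<ge> 1" using N \<zeta> by simp
  have reg: "AE \<delta> in P. convex_on UNIV (\<lambda>x. g x \<delta>)"
    "\<And>n. n \<ge> 1 \<Longrightarrow> AE \<omega> in multisample n P. \<exists>x. sp_feasible X g n \<omega> x"
    "\<And>n. n \<ge> 1 \<Longrightarrow> AE \<omega> in multisample n P. \<exists>!x. sp_solution cost X g n \<omega> x"
    "\<And>x. x \<in> X \<Longrightarrow> g x \<in> borel_measurable P"
    using assms(8) by (auto simp: standing_regularity_def elim: eventually_mono)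
  obtain N0 where N0: "{\<delta>\<in>space P. \<not> convex_on UNIV (\<lambda>x. g x \<delta>)} \<subseteq> N0" "emeasure P N0 = 0" "N0 \<in> sets P"
    using reg(1) by (rule AE_E)
  \<comment> \<open>Setting \<open>g\<close> to 0 on a null set makes convexity hold for every
    \<open>\<delta>\<close>; the value 0 satisfies the constraint, so feasible points stay
    feasible.\<close>
  define g' where "g' x \<delta> = (if \<delta> \<in> space P - N0 then g x \<delta> else 0)" for x \<delta>
  have AE_N0: "AE \<delta> in P. \<delta> \<notin> N0" using N0(2,3) by (intro AE_not_in) (simp add: null_sets_def)
  have AE_good: "AE \<omega> in multisample n P. \<forall>j\<in>{1..n}. \<omega> j \<in> space P - N0" for n
  proof (rule AE_finite_allI)
    fix j assume "j \<in> {1..n}"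
    moreover have "AE \<delta> in P. \<delta> \<in> space P - N0" using AE_N0 AE_space by eventually_elim simp
    ultimately show "AE \<omega> in multisample n P. \<omega> j \<in> space P - N0"
      by (intro AE_PiM_component assms(1)) auto
  qed simp
  obtain K where K: "\<And>x. x \<in> X \<Longrightarrow> norm x \<le> K"
    using compact_imp_bounded[OF assms(3)] by (auto simp: bounded_iff)
  \<comment> \<open>The first two terms bound the objective on \<open>X\<close> for all \<rho> \<le>
    1, by Cauchy-Schwarz; the summand 1 makes the bound strict.\<close>
  define T where "T = norm cost * K + K\<^sup>2 + 1"
  interpret scenario P X cost T g' \<zeta>
  proof
    show "cost \<bullet> x + \<rho> * (x \<bullet> x) < T" if "x \<in> X" "0 \<le> \<rho>" "\<rho> \<le> 1" for x \<rho>
    proof -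
      have "cost \<bullet> x \<le> norm cost * norm x" by (rule norm_cauchy_schwarz)
      also have "\<dots> \<le> norm cost * K" using K[OF that(1)] by (intro mult_left_mono) auto
      finally have "cost \<bullet> x \<le> norm cost * K" .
      moreover have "\<rho> * (x \<bullet> x) \<le> 1 * (norm x)\<^sup>2"
        unfolding power2_norm_eq_inner using that by (intro mult_right_mono) auto
      moreover have "(norm x)\<^sup>2 \<le> K\<^sup>2" using K[OF that(1)] by (intro power_mono) auto
      ultimately show ?thesis by (simp add: T_def)
    qed
    show "convex_on UNIV (\<lambda>x. g' x \<delta>)" for \<delta>
    proof (cases "\<delta> \<in> space P - N0")
      case True
      then have "convex_on UNIV (\<lambda>x. g x \<delta>)" using N0(1) by blast
      then show ?thesis using True by (simp add: g'_def)
    next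
      case False
      then have "(\<lambda>x. g' x \<delta>) = (\<lambda>_. 0)" by (auto simp: g'_def)
      then show ?thesis by (simp add: convex_on_const)
    qed
    show "g' x \<in> borel_measurable P" if "x \<in> X" for x
      unfolding g'_def using reg(4)[OF that] N0(3) by (intro measurable_If_set) auto
    show "AE \<omega> in Pi\<^sub>M {1..n} (\<lambda>_. P). \<exists>x\<in>X. \<forall>j\<in>{1..n}. g' x (\<omega> j) \<le> 0" if "n \<ge> 1" for n :: nat
      using reg(2)[OF that] by eventually_elim (auto simp: sp_feasible_def g'_def)
    show "AE \<omega> in Pi\<^sub>M {1..n} (\<lambda>_. P). rank_bounded \<zeta> X (\<lambda>x k. g' x (\<omega> k)) {1..n}" for n :: nat
      using AE_good[of n]
    proof eventually_elim
      case (elim \<omega>)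
      show ?case
        unfolding assms(13)
      proof (rule rank_bounded_max_quadratic[OF assms(5), where gi = gi and A = A and b = b and c = c])
        show "gi i x (\<omega> k) = \<omega> k \<bullet> (A i x *v \<omega> k) + b i x \<bullet> \<omega> k + c i x"
          if "i \<in> {1..r}" "k \<in> {1..n}" for i x k
          using elim that assms(2) by (intro assms(6)) auto
        show "g' x (\<omega> k) = Max ((\<lambda>i. gi i x (\<omega> k)) ` {1..r})" if "k \<in> {1..n}" for x k
          using elim that assms(2) assms(7)[of "\<omega> k" x] by (simp add: g'_def)
      qed
    qed
  qed (use assms(3,4) \<zeta> in auto)
  obtain E where E: "E \<in> sets (multisample N P)"
    "1 - (\<Sum>j<\<zeta>. real (N choose j) * \<epsilon> ^ j * (1 - \<epsilon>) ^ (N - j)) \<le> measure (multisample N P) E"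
    and risk: "\<And>\<omega> x. \<omega> \<in> E \<Longrightarrow> x \<in> X \<Longrightarrow> \<forall>j\<in>{1..N}. g' x (\<omega> j) \<le> 0 \<Longrightarrow>
      \<forall>y\<in>X. (\<forall>j\<in>{1..N}. g' y (\<omega> j) \<le> 0) \<longrightarrow> y \<noteq> x \<longrightarrow> cost \<bullet> x < cost \<bullet> y \<Longrightarrow>
      1 - \<epsilon> \<le> P.prob {\<delta>\<in>space P. g' x \<delta> \<le> 0}"
    using confidence[OF N assms(9) less_imp_le[OF assms(10)]] by blast
  \<comment> \<open>As long as no sample hits \<open>N0\<close>, the programs for \<open>g\<close>
    and \<open>g'\<close> have the same feasible points. The exceptional multi-samples form part of
    a null set \<open>M0\<close>, and removing it from \<open>E\<close> does not change the
    measure.\<close>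
  have "AE \<omega> in multisample N P. (\<exists>!x. sp_solution cost X g N \<omega> x) \<and> (\<forall>j\<in>{1..N}. \<omega> j \<in> space P - N0)"
    using reg(3)[OF N1] AE_good[of N] by eventually_elim simp
  then obtain M0 where M0: "{\<omega>\<in>space (multisample N P). \<not> ((\<exists>!x. sp_solution cost X g N \<omega> x) \<and>
      (\<forall>j\<in>{1..N}. \<omega> j \<in> space P - N0))} \<subseteq> M0" "emeasure (multisample N P) M0 = 0" "M0 \<in> sets (multisample N P)"
    by (rule AE_E)
  show ?thesis
    unfolding with_confidence_def
  proof (intro bexI conjI ballI allI impI)
    show "E - M0 \<in> sets (multisample N P)" using E(1) M0(3) by auto
    have "measure (multisample N P) (E - M0) = measure (multisample N P) E"
      using E(1) M0(2,3) by (intro measure_Diff_null_set) (auto simp: null_sets_def)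
    then show "1 - \<beta> \<le> measure (multisample N P) (E - M0)" using E(2) assms(14) sum_eq by simp
  next
    fix \<omega> assume \<omega>: "\<omega> \<in> E - M0"
    then have "\<omega> \<in> space (multisample N P)" using E(1) sets.sets_into_space by blast
    then have ex1: "\<exists>!x. sp_solution cost X g N \<omega> x" and good: "\<And>j. j \<in> {1..N} \<Longrightarrow> \<omega> j \<in> space P - N0"
      using \<omega> M0(1) by blast+
    show "\<exists>!x. sp_solution cost X g N \<omega> x" by fact
    fix x assume x: "sp_solution cost X g N \<omega> x"
    have feas_iff: "sp_feasible X g N \<omega> y \<longleftrightarrow> y \<in> X \<and> (\<forall>j\<in>{1..N}. g' y (\<omega> j) \<le> 0)" for y
      using good by (simp add: sp_feasible_def g'_def)
    have xf: "sp_feasible X g N \<omega> x" and opt: "\<And>y. sp_feasible X g N \<omega> y \<Longrightarrow> \<not> cost \<bullet> y < cost \<bullet> x"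
      using x by (auto simp: sp_solution_def is_arg_min_def)
    have "1 - \<epsilon> \<le> P.prob {\<delta>\<in>space P. g' x \<delta> \<le> 0}"
    proof (rule risk, safe)
      fix y assume y: "y \<in> X" "\<forall>j\<in>{1..N}. g' y (\<omega> j) \<le> 0" "y \<noteq> x"
      then have yf: "sp_feasible X g N \<omega> y" using feas_iff by blast
      show "cost \<bullet> x < cost \<bullet> y"
      proof (rule ccontr)
        assume "\<not> cost \<bullet> x < cost \<bullet> y"
        then have "sp_solution cost X g N \<omega> y"
          using yf opt by (force simp: sp_solution_def is_arg_min_def)
        then show False using ex1 x y(3) by blast
      qed
    qed (use \<omega> xf feas_iff in auto)
    also have "P.prob {\<delta>\<in>space P. g' x \<delta> \<le> 0} = P.prob {\<delta>\<in>space P. g x \<delta> \<le> 0}"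
    proof (rule P.finite_measure_eq_AE)
      have "x \<in> X" using xf by (simp add: sp_feasible_def)
      note [measurable] = reg(4)[OF this] measurable_g[OF this]
      show "{\<delta>\<in>space P. g' x \<delta> \<le> 0} \<in> P.events" "{\<delta>\<in>space P. g x \<delta> \<le> 0} \<in> P.events" by measurable
      show "AE \<delta> in P. \<delta> \<in> {\<delta>\<in>space P. g' x \<delta> \<le> 0} \<longleftrightarrow> \<delta> \<in> {\<delta>\<in>space P. g x \<delta> \<le> 0}"
        using AE_N0 AE_space by eventually_elim (simp add: g'_def)
    qed
    finally show "ccp_feasible P X g \<epsilon> x" using xf by (simp add: ccp_feasible_def sp_feasible_def)
  qed
qed

end
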